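(* Let $Z=(Y,X)=\xi\cdot(V,W)$ be a Pareto-Breiman model as in the context, with associated $(U,\Theta)$. Suppose that $g\in L^1_+(b\cdot p_\Theta)$ satisfies $C(g)=\mathbb E[(1-U)g(\Theta)]=\mathbb E[U]$ and $$\Lambda(g)=\sup_{f\in L^1_+(b\cdot p_\Theta),\ C(f)=\mathbb E[U]}\Lambda(f).$$ Define the homogeneous extension $h_g(x):=\tau_X(x)\,g(x/\tau_X(x))$, $x\in\mathbb R^d$, where by convention $h_g(x)=0$ whenever $\tau_X(x)=0$. Then: (i) We have $$\lim_{t\to\infty}t\,\mathbb P[Y>t]=\lim_{t\to\infty}t\,\mathbb P[h_g(X)>t]=c_\xi\,\mathbb E[\tau(V,W)]\,C(g).$$ (ii) For every non-negative, $1$-homogeneous and Borel measurable function $h:\mathbb R^d\to[0,\infty)$ such that $\{h>0\}\subset\{\tau_X>0\}$ and $\mathbb P[Y>t]\sim\mathbb P[h(X)>t]$, $t\to\infty$, we have $h|_{S_X}\in L^1_+(b\cdot p_\Theta)$ and $$\Lambda(h)=\lambda(Y,h(X))=\lim_{t\to\infty}\mathbb P[Y>t\mid h(X)>t]\le\Lambda(g)=\lambda(Y,h_g(X)),$$ where the limit $\lim_{t\to\infty}\mathbb P[Y>t\mid h(X)>t]$ and the limits defining the tail-dependence coefficients $\lambda(Y,h(X))$ and $\lambda(Y,h_g(X))$ exist.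
   Context: Pareto-Breiman model: $\xi\ge0$ is a random variable independent of the random vector $(V,W)=(V,W_1,\dots,W_d)$ with $V\ge0$; $t\,\mathbb P[\xi>t]\to c_\xi\in(0,\infty)$ as $t\to\infty$; $\tau(y,x)=y_++\tau_X(x)$ where $\tau_X:\mathbb R^d\to[0,\infty)$ is continuous and $1$-homogeneous ($\tau_X(cx)=c\tau_X(x)$, $c\ge0$); $0<\mathbb E[V]<\infty$ and $0<\mathbb E[\tau_X(W)]<\infty$. Then the conditional law of $(Y,X)/\tau(Y,X)$ given $\tau(Y,X)>t$ converges (in total variation) as $t\to\infty$ to the law of a random vector $\Theta_Z=:(U,(1-U)\Theta)$ on $\{\tau=1\}$, where $U\in[0,1]$, $\Theta\in S_X=\{\tau_X=1\}$, and where $\Theta:=\theta_*$ for a fixed $\theta_*\in S_X$, with $\sigma_X(\{\theta_*\})=0$, when $U=1$; here $\sigma_X$ is the limit law, as $t\to\infty$, of $X/\tau_X(X)$ given $\tau_X(X)>t$. $p_\Theta$ is the law of $\Theta$, $p(du|\theta)$ the regular conditional law of $U$ given $\Theta=\theta$, $b(\theta)=\int_{[0,1]}(1-u)p(du|\theta)$; $L^1_+(b\cdot p_\Theta)$ is the set of non-negative measurable $f$ on $S_X$ with $C(f):=\mathbb E[(1-U)f(\Theta)]=\int f\,b\,dp_\Theta<\infty$; $\Lambda(f)=\frac1{\mathbb E[U]}\mathbb E[U\wedge(1-U)f(\Theta)]$, and $\Lambda(h)$ for a function $h$ on $\mathbb R^d$ means $\Lambda(h|_{S_X})$. $\lambda(\xi_1,\xi_2)=\lim_{p\uparrow1}\mathbb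 P[\xi_1>F_{\xi_1}^\leftarrow(p)\mid\xi_2>F_{\xi_2}^\leftarrow(p)]$ is the tail-dependence coefficient ($F^\leftarrow$ the left-continuous generalized inverse of the cdf). *)

theory Defs
  imports "HOL-Probability.Probability" "HOL-Library.Landau_Symbols"
begin

section \<open>Conditional laws, total variation, tail dependence\<close>

definition cond_law :: "'a measure \<Rightarrow> ('a \<Rightarrow> bool) \<Rightarrow> ('a \<Rightarrow> 'b::topological_space) \<Rightarrow> 'b measure"
  where "cond_law M P f = distr (uniform_measure M {\<omega> \<in> space M. P \<omega>}) borel f"

definition tv_dist :: "'a measure \<Rightarrow> 'a measure \<Rightarrow> real"
  where "tv_dist \<mu> \<nu> = (SUP A\<in>sets \<nu>. \<bar>measure \<mu> A - measure \<nu> A\<bar>)"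

definition quantile :: "'a measure \<Rightarrow> ('a \<Rightarrow> real) \<Rightarrow> real \<Rightarrow> real"
  where "quantile M \<zeta> p = Inf {x. p \<le> cdf (distr M borel \<zeta>) x}"

text \<open>The limit defining the tail-dependence coefficient of \<open>\<zeta>\<^sub>1, \<zeta>\<^sub>2\<close> exists and equals \<open>l\<close>.\<close>

definition has_tail_dependence :: "'a measure \<Rightarrow> ('a \<Rightarrow> real) \<Rightarrow> ('a \<Rightarrow> real) \<Rightarrow> real \<Rightarrow> bool"
  where "has_tail_dependence M \<zeta>1 \<zeta>2 l \<longleftrightarrow>
    ((\<lambda>p. \<P>(\<omega> in M. \<zeta>1 \<omega> > quantile M \<zeta>1 p \<bar> \<zeta>2 \<omega> > quantile M \<zeta>2 p)) \<longlongrightarrow> l) (at_left 1)"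

section \<open>The Pareto-Breiman model\<close>

definition homogeneous :: "('v::real_vector \<Rightarrow> real) \<Rightarrow> bool"
  where "homogeneous f \<longleftrightarrow> (\<forall>c\<ge>0. \<forall>x. f (c *\<^sub>R x) = c * f x)"

definition tau :: "('v \<Rightarrow> real) \<Rightarrow> real \<times> 'v \<Rightarrow> real"
  where "tau \<tau>X z = max 0 (fst z) + \<tau>X (snd z)"

locale pareto_breiman = prob_space M
  for M :: "'a measure" +
  fixes \<xi> V :: "'a \<Rightarrow> real" and W :: "'a \<Rightarrow> real ^ 'd"
    and \<tau>X :: "real ^ 'd \<Rightarrow> real" and c\<xi> :: real
  assumes xi_measurable: "\<xi> \<in> borel_measurable M"
    and V_measurable: "V \<in> borel_measurable M"
    and W_measurable: "W \<in> borel_measurable M"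
    and indep: "indep_set {\<xi> -` A \<inter> space M | A. A \<in> sets borel}
      {(\<lambda>\<omega>. (V \<omega>, W \<omega>)) -` B \<inter> space M | B. B \<in> sets borel}"
    and xi_nonneg: "AE \<omega> in M. 0 \<le> \<xi> \<omega>"
    and V_nonneg: "AE \<omega> in M. 0 \<le> V \<omega>"
    and c_xi_pos: "0 < c\<xi>"
    and xi_tail: "((\<lambda>t. t * \<P>(\<omega> in M. \<xi> \<omega> > t)) \<longlongrightarrow> c\<xi>) at_top"
    and tauX_nonneg: "\<And>x. 0 \<le> \<tau>X x"
    and tauX_continuous: "continuous_on UNIV \<tau>X"
    and tauX_homogeneous: "homogeneous \<tau>X"
    and V_integrable: "integrable M V"
    and V_expectation_pos: "0 < expectation V"
    and tauX_W_integrable: "integrable M (\<lambda>\<omega>. \<tau>X (W \<omega>))"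
    and tauX_W_expectation_pos: "0 < expectation (\<lambda>\<omega>. \<tau>X (W \<omega>))"

abbreviation SX :: "(real ^ 'd \<Rightarrow> real) \<Rightarrow> (real ^ 'd) measure"
  where "SX \<tau>X \<equiv> restrict_space borel {x. \<tau>X x = 1}"

text \<open>\<open>\<sigma>X\<close> is the limit law of \<open>X / \<tau>X X\<close> given \<open>\<tau>X X > t\<close>, and \<open>\<Theta>Z\<close>, defined on some
  probability space \<open>N\<close>, has the limit law of \<open>Z / \<tau> Z\<close> given \<open>\<tau> Z > t\<close>.  The identity
  \<open>\<Theta>Z = (U, (1 - U) \<Theta>)\<close> is required only where \<open>U < 1\<close>: as \<open>\<tau>X\<close> may vanish outside
  the origin, \<open>U = 1\<close> does not force the second component of \<open>\<Theta>Z\<close> to be zero.\<close>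

locale pareto_breiman_limit =
  pareto_breiman M \<xi> V W \<tau>X c\<xi> + N: prob_space N + \<sigma>: prob_space \<sigma>X
  for M :: "'a measure" and \<xi> V :: "'a \<Rightarrow> real" and W :: "'a \<Rightarrow> real ^ 'd"
    and \<tau>X :: "real ^ 'd \<Rightarrow> real" and c\<xi> :: real
    and N :: "'b measure" and \<sigma>X :: "(real ^ 'd) measure" +
  fixes \<Theta>Z :: "'b \<Rightarrow> real \<times> (real ^ 'd)" and U :: "'b \<Rightarrow> real" and \<Theta> :: "'b \<Rightarrow> real ^ 'd"
    and \<theta>s :: "real ^ 'd"
  assumes ThetaZ_measurable: "\<Theta>Z \<in> borel_measurable N"
    and tau_ThetaZ: "\<And>\<omega>. \<omega> \<in> space N \<Longrightarrow> tau \<tau>X (\<Theta>Z \<omega>) = 1"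
    and limit_law: "((\<lambda>t. tv_dist
          (cond_law M (\<lambda>\<omega>. tau \<tau>X (\<xi> \<omega> *\<^sub>R (V \<omega>, W \<omega>)) > t)
            (\<lambda>\<omega>. (\<xi> \<omega> *\<^sub>R (V \<omega>, W \<omega>)) /\<^sub>R tau \<tau>X (\<xi> \<omega> *\<^sub>R (V \<omega>, W \<omega>))))
          (distr N borel \<Theta>Z)) \<longlongrightarrow> 0) at_top"
    and sets_sigmaX: "sets \<sigma>X = sets borel"
    and limit_law_X: "((\<lambda>t. tv_dist
          (cond_law M (\<lambda>\<omega>. \<tau>X (\<xi> \<omega> *\<^sub>R W \<omega>) > t)
            (\<lambda>\<omega>. (\<xi> \<omega> *\<^sub>R W \<omega>) /\<^sub>R \<tau>X (\<xi> \<omega> *\<^sub>R W \<omega>)))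
          \<sigma>X) \<longlongrightarrow> 0) at_top"
    and U_eq: "\<And>\<omega>. \<omega> \<in> space N \<Longrightarrow> U \<omega> = fst (\<Theta>Z \<omega>)"
    and U_range: "\<And>\<omega>. \<omega> \<in> space N \<Longrightarrow> U \<omega> \<in> {0..1}"
    and Theta_measurable: "\<Theta> \<in> measurable N (SX \<tau>X)"
    and Theta_eq: "\<And>\<omega>. \<omega> \<in> space N \<Longrightarrow> U \<omega> < 1 \<Longrightarrow> snd (\<Theta>Z \<omega>) = (1 - U \<omega>) *\<^sub>R \<Theta> \<omega>"
    and theta_star: "\<tau>X \<theta>s = 1" "measure \<sigma>X {\<theta>s} = 0"
    and Theta_star: "\<And>\<omega>. \<omega> \<in> space N \<Longrightarrow> U \<omega> = 1 \<Longrightarrow> \<Theta> \<omega> = \<theta>s"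

section \<open>The functionals \<open>C\<close> and \<open>\<Lambda>\<close>\<close>

definition regular_cond_law ::
    "'b measure \<Rightarrow> ('b \<Rightarrow> real) \<Rightarrow> 'v measure \<Rightarrow> ('b \<Rightarrow> 'v) \<Rightarrow> ('v \<Rightarrow> real measure) \<Rightarrow> bool"
  where "regular_cond_law N U S \<Theta> p \<longleftrightarrow> p \<in> measurable S (prob_algebra borel) \<and>
    (\<forall>A\<in>sets borel. \<forall>B\<in>sets S. emeasure N {\<omega> \<in> space N. U \<omega> \<in> A \<and> \<Theta> \<omega> \<in> B}
      = (\<integral>\<^sup>+\<theta>\<in>B. emeasure (p \<theta>) A \<partial>distr N S \<Theta>))"

definition b_fun :: "('v \<Rightarrow> real measure) \<Rightarrow> 'v \<Rightarrow> real"
  where "b_fun p \<theta> = (LINT u:{0..1}|p \<theta>. 1 - u)"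

definition L1_plus :: "'v measure \<Rightarrow> ('v \<Rightarrow> real) \<Rightarrow> ('v \<Rightarrow> real) set"
  where "L1_plus \<mu> b = {f. (\<forall>\<theta>\<in>space \<mu>. 0 \<le> f \<theta>) \<and> integrable (density \<mu> (\<lambda>\<theta>. ennreal (b \<theta>))) f}"

definition C_fun :: "'b measure \<Rightarrow> ('b \<Rightarrow> real) \<Rightarrow> ('b \<Rightarrow> 'v) \<Rightarrow> ('v \<Rightarrow> real) \<Rightarrow> real"
  where "C_fun N U \<Theta> f = (\<integral>\<omega>. (1 - U \<omega>) * f (\<Theta> \<omega>) \<partial>N)"

definition Lambda :: "'b measure \<Rightarrow> ('b \<Rightarrow> real) \<Rightarrow> ('b \<Rightarrow> 'v) \<Rightarrow> ('v \<Rightarrow> real) \<Rightarrow> real"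
  where "Lambda N U \<Theta> f = (\<integral>\<omega>. min (U \<omega>) ((1 - U \<omega>) * f (\<Theta> \<omega>)) \<partial>N) / (\<integral>\<omega>. U \<omega> \<partial>N)"

definition hom_ext :: "('v::real_vector \<Rightarrow> real) \<Rightarrow> ('v \<Rightarrow> real) \<Rightarrow> 'v \<Rightarrow> real"
  where "hom_ext \<tau>X g x = (if \<tau>X x = 0 then 0 else \<tau>X x * g (x /\<^sub>R \<tau>X x))"

end

(* By independence and dominated convergence, t P(\<xi> R > t) tends to c\<xi> E R for integrable
   R \<ge> 0 that depend on (V, W) only.  Applied to R = \<tau>(V, W) times the indicator of
   (V, W) / \<tau>(V, W) \<in> A, this identifies the law of \<Theta>Z as the law of (V, W) / \<tau>(V, W) under the
   probability with density \<tau>(V, W) / E \<tau>(V, W).  So E H(V, W) = E \<tau>(V, W) * E H(\<Theta>Z) for every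
   non-negative homogeneous H vanishing on {\<tau> = 0}.  The choices v, h(w) and min(v, h(w)) of
   H(v, w) give the tails of Y, of h(X) and of the joint exceedance in terms of E U, C(h) and
   \<Lambda>(h).  If C(h) = E U, the first two tails agree, hence so do the two quantiles
   asymptotically, and the tail-dependence coefficient is the quotient of the joint tail by the
   common one. *)

theory Submission
  imports Defs
begin


section \<open>Breiman's lemma\<close>

text \<open>The function \<open>h\<close> is merely Borel and may be unbounded on the set where
  \<open>\<tau>X\<close> is 1, so convergence in total variation to the law of
  \<open>\<Theta>Z\<close> does not by itself control the tail of \<open>h (X)\<close>. That
  convergence is used set by set to pin down the limit law; afterwards every tail constant is an
  exact integral of a homogeneous function. In (ii), finiteness of E h(W) is not given either: it is
  forced by the 1/t tail of \<open>h (X)\<close>, which bounds E min(h(W), n) uniformly in n. Two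
  degeneracies shape the rest. \<open>\<tau>X\<close> may vanish away from the origin, so where U =
  1 the second component of \<open>\<Theta>Z\<close> can be nonzero; there the condition {h > 0}
  \<subseteq> {\<open>\<tau>X\<close> > 0} makes \<open>h\<close> vanish. And the distribution
  functions may jump, so a quantile need not attain its level, and the quantiles of Y and
  \<open>h (X)\<close> agree only to first order.\<close>

text \<open>A tail function is monotone, hence Borel. The composed form serves the random threshold
  \<open>t / R \<omega>\<close> that appears when conditioning on \<open>R\<close>.\<close>

lemma (in prob_space) borel_measurable_prob_gt [measurable (raw)]:
  fixes \<xi> :: "'a \<Rightarrow> real"
  assumes [measurable]: "\<xi> \<in> borel_measurable M" "f \<in> borel_measurable K"
  shows "(\<lambda>x. \<P>(\<omega> in M. \<xi> \<omega> > f x)) \<in> borel_measurable K"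
proof -
  have "mono (\<lambda>s. - \<P>(\<omega> in M. \<xi> \<omega> > s))"
    by (auto simp: mono_def intro!: finite_measure_mono)
  then have "(\<lambda>s. - (- \<P>(\<omega> in M. \<xi> \<omega> > s))) \<in> borel_measurable borel"
    by (intro borel_measurable_uminus borel_measurable_mono)
  from measurable_compose[OF assms(2) this] show ?thesis by simp
qed

text \<open>Fubini for the product law of (R, \<xi>). The guard at \<open>R \<omega> = 0\<close>
  matters: there the product never exceeds t > 0, whereas \<open>t / 0 = 0\<close> would contribute
  the probability of \<xi> > 0.\<close>

lemma (in prob_space) prob_indep_mult_gt:
  fixes \<xi> R :: "'a \<Rightarrow> real"
  assumes indep: "indep_var borel \<xi> borel R"
    and R_nonneg: "\<And>\<omega>. 0 \<le> R \<omega>" and t: "0 < t"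
  shows "\<P>(\<omega> in M. \<xi> \<omega> * R \<omega> > t)
      = (\<integral>\<omega>. (if R \<omega> = 0 then 0 else \<P>(\<omega>' in M. \<xi> \<omega>' > t / R \<omega>)) \<partial>M)"
proof -
  have [measurable]: "\<xi> \<in> borel_measurable M" "R \<in> borel_measurable M"
    using indep_var_rv1[OF indep] indep_var_rv2[OF indep] by auto
  \<comment> \<open>Independence is turned around because the slicing formula for product measures
    fixes the first coordinate, which has to be \<open>R\<close>.\<close>
  have "indep_set B A" if "indep_set A B" for A B
  proof -
    have "prob (a \<inter> b) = prob a * prob b" if "a \<in> B" "b \<in> A" for a b
      using \<open>indep_set A B\<close> that unfolding indep_sets2_eq
      by (subst Int_commute, subst mult.commute) blast
    then show ?thesis using that unfolding indep_sets2_eq by blast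
  qed
  then have "indep_var borel R borel \<xi>"
    using indep unfolding indep_var_eq by blast
  then have prod: "distr M (borel \<Otimes>\<^sub>M borel) (\<lambda>\<omega>. (R \<omega>, \<xi> \<omega>)) = distr M borel R \<Otimes>\<^sub>M distr M borel \<xi>"
    by (simp add: indep_var_distribution_eq)
  interpret X: prob_space "distr M borel \<xi>" by (rule prob_space_distr) simp
  define A where "A = {z \<in> space (borel \<Otimes>\<^sub>M borel). snd z * fst z > (t::real)}"
  have A [measurable]: "A \<in> sets (borel \<Otimes>\<^sub>M borel)"
    unfolding A_def by (intro borel_measurable_less) measurable
  have section_eq: "{\<omega> \<in> space M. \<xi> \<omega> * R \<omega>' > t}
      = (if R \<omega>' = 0 then {} else {\<omega> \<in> space M. \<xi> \<omega> > t / R \<omega>'})" for \<omega>'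
    using R_nonneg[of \<omega>'] t by (auto simp: field_simps)
  have "emeasure M {\<omega> \<in> space M. \<xi> \<omega> * R \<omega> > t}
      = emeasure (distr M (borel \<Otimes>\<^sub>M borel) (\<lambda>\<omega>. (R \<omega>, \<xi> \<omega>))) A"
    by (subst emeasure_distr[OF _ A], measurable)
      (auto simp: A_def space_pair_measure intro!: arg_cong[where f = "emeasure M"])
  also have "\<dots> = (\<integral>\<^sup>+r. emeasure (distr M borel \<xi>) (Pair r -` A) \<partial>distr M borel R)"
    unfolding prod by (subst X.emeasure_pair_measure_alt) (auto cong: sets_pair_measure_cong)
  also have "\<dots> = (\<integral>\<^sup>+\<omega>. emeasure (distr M borel \<xi>) (Pair (R \<omega>) -` A) \<partial>M)"
    by (subst nn_integral_distr)
      (auto intro!: X.measurable_emeasure_Pair[of A] cong: sets_pair_measure_cong)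
  also have "\<dots> = (\<integral>\<^sup>+\<omega>. emeasure M {\<omega>' \<in> space M. \<xi> \<omega>' * R \<omega> > t} \<partial>M)"
  proof (rule nn_integral_cong)
    fix \<omega>
    have "Pair (R \<omega>) -` A \<in> sets borel"
      using sets_Pair1[OF A] by simp
    then show "emeasure (distr M borel \<xi>) (Pair (R \<omega>) -` A)
        = emeasure M {\<omega>' \<in> space M. \<xi> \<omega>' * R \<omega> > t}"
      by (subst emeasure_distr)
        (auto simp: A_def space_pair_measure intro!: arg_cong[where f = "emeasure M"])
  qed
  also have "\<dots> = (\<integral>\<^sup>+\<omega>. ennreal (if R \<omega> = 0 then 0 else \<P>(\<omega>' in M. \<xi> \<omega>' > t / R \<omega>)) \<partial>M)"
    unfolding section_eq by (rule nn_integral_cong) (simp add: emeasure_eq_measure)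
  finally have *: "ennreal \<P>(\<omega> in M. \<xi> \<omega> * R \<omega> > t) = \<dots>"
    by (simp add: emeasure_eq_measure)
  have meas: "(\<lambda>\<omega>. if R \<omega> = 0 then 0 else \<P>(\<omega>' in M. \<xi> \<omega>' > t / R \<omega>)) \<in> borel_measurable M"
    by measurable
  show ?thesis
    by (subst integral_eq_nn_integral) (use meas * in \<open>auto simp flip: *\<close>)
qed

text \<open>Convergence bounds the product beyond some \<open>s0\<close>; below \<open>s0\<close> a
  probability is at most 1, so the product is at most \<open>s0\<close>. This uniform bound is what
  dominates the integrand in Breiman's lemma.\<close>

lemma (in prob_space) tail_bounded:
  assumes "((\<lambda>t. t * \<P>(\<omega> in M. \<xi> \<omega> > t)) \<longlongrightarrow> c) at_top"
  obtains K where "\<And>s. 0 < s \<Longrightarrow> s * \<P>(\<omega> in M. \<xi> \<omega> > s) \<le> K"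
proof -
  have "\<forall>\<^sub>F t in at_top. t * \<P>(\<omega> in M. \<xi> \<omega> > t) < c + 1"
    using assms by (intro order_tendstoD(2)[OF assms]) auto
  then obtain s0 where s0: "\<And>s. s0 \<le> s \<Longrightarrow> s * \<P>(\<omega> in M. \<xi> \<omega> > s) < c + 1"
    by (auto simp: eventually_at_top_linorder)
  have "s * \<P>(\<omega> in M. \<xi> \<omega> > s) \<le> max (c + 1) s0" if "0 < s" for s
  proof (cases "s0 \<le> s")
    case True
    then show ?thesis using s0[of s] by simp
  next
    case False
    have "s * \<P>(\<omega> in M. \<xi> \<omega> > s) \<le> s * 1" using that by (intro mult_left_mono) auto
    then show ?thesis using False by simp
  qed
  then show thesis by (rule that)
qed

text \<open>Conditionally on \<open>R\<close>, the rescaled tail is \<open>R \<omega>\<close> times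
  the function s P(\<xi> > s) at s = \<open>t / R \<omega>\<close>. That function tends to
  \<open>c\<close> and is bounded by \<open>K\<close>, so \<open>K * R \<omega>\<close> dominates
  and a first moment of \<open>R\<close> suffices.\<close>

lemma (in prob_space) breiman:
  fixes \<xi> R :: "'a \<Rightarrow> real"
  assumes indep: "indep_var borel \<xi> borel R"
    and tail: "((\<lambda>t. t * \<P>(\<omega> in M. \<xi> \<omega> > t)) \<longlongrightarrow> c) at_top"
    and R_nonneg: "\<And>\<omega>. 0 \<le> R \<omega>" and R_int: "integrable M R"
  shows "((\<lambda>t. t * \<P>(\<omega> in M. \<xi> \<omega> * R \<omega> > t)) \<longlongrightarrow> c * expectation R) at_top"
proof -
  define s where "s = (\<lambda>t \<omega>. t * (if R \<omega> = 0 then 0 else \<P>(\<omega>' in M. \<xi> \<omega>' > t / R \<omega>)))"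
  obtain K where K: "\<And>s. 0 < s \<Longrightarrow> s * \<P>(\<omega> in M. \<xi> \<omega> > s) \<le> K"
    using tail_bounded[OF tail] by metis
  have [measurable]: "\<xi> \<in> borel_measurable M" "R \<in> borel_measurable M"
    using indep_var_rv1[OF indep] indep_var_rv2[OF indep] by auto
  \<comment> \<open>Valid also for \<open>R \<omega> = 0\<close>, where both sides are 0.\<close>
  have s_eq: "s t \<omega> = R \<omega> * (t / R \<omega> * \<P>(\<omega>' in M. \<xi> \<omega>' > t / R \<omega>))" for t \<omega>
    by (simp add: s_def)
  have meas: "s t \<in> borel_measurable M" for t
    unfolding s_def by measurable
  have "((\<lambda>t. integral\<^sup>L M (s t)) \<longlongrightarrow> integral\<^sup>L M (\<lambda>\<omega>. c * R \<omega>)) at_top"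
  proof (rule integral_dominated_convergence_at_top[where w = "\<lambda>\<omega>. K * R \<omega>"])
    show "AE \<omega> in M. ((\<lambda>t. s t \<omega>) \<longlongrightarrow> c * R \<omega>) at_top"
    proof (rule AE_I2)
      fix \<omega>
      show "((\<lambda>t. s t \<omega>) \<longlongrightarrow> c * R \<omega>) at_top"
      proof (cases "R \<omega> = 0")
        case False
        then have "filterlim (\<lambda>t. t * inverse (R \<omega>)) at_top at_top"
          using R_nonneg[of \<omega>]
          by (intro filterlim_at_top_mult_tendsto_pos[OF tendsto_const] filterlim_ident) auto
        from filterlim_compose[OF tail this] show ?thesis
          unfolding s_eq by (subst mult.commute[of c], intro tendsto_mult_left) (simp add: field_simps)
      qed (simp add: s_def)
    qed
    show "\<forall>\<^sub>F t in at_top. AE \<omega> in M. norm (s t \<omega>) \<le> K * R \<omega>"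
      using eventually_gt_at_top[of 0]
    proof eventually_elim
      case (elim t)
      have "s t \<omega> \<le> K * R \<omega>" for \<omega>
        using K[of "t / R \<omega>"] R_nonneg[of \<omega>] elim
        by (cases "R \<omega> = 0") (auto simp: s_def field_simps)
      moreover have "0 \<le> s t \<omega>" for \<omega> using elim by (simp add: s_def)
      ultimately show ?case by simp
    qed
  qed (use meas R_int in auto)
  then have "((\<lambda>t. integral\<^sup>L M (s t)) \<longlongrightarrow> c * expectation R) at_top" by simp
  then show ?thesis
  proof (rule Lim_transform_eventually)
    show "\<forall>\<^sub>F t in at_top. integral\<^sup>L M (s t) = t * \<P>(\<omega> in M. \<xi> \<omega> * R \<omega> > t)"
      using eventually_gt_at_top[of 0]
      by eventually_elim (simp add: prob_indep_mult_gt[OF indep R_nonneg] s_def)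
  qed
qed

text \<open>By truncation of \<open>R\<close>: \<open>c * E[min R n] \<le> l\<close> for every \<open>n\<close>.\<close>

lemma (in prob_space) breiman_integrable:
  fixes \<xi> R :: "'a \<Rightarrow> real"
  assumes indep: "indep_var borel \<xi> borel R"
    and tail: "((\<lambda>t. t * \<P>(\<omega> in M. \<xi> \<omega> > t)) \<longlongrightarrow> c) at_top" and c: "0 < c"
    and R_nonneg: "\<And>\<omega>. 0 \<le> R \<omega>"
    and lim: "((\<lambda>t. t * \<P>(\<omega> in M. \<xi> \<omega> * R \<omega> > t)) \<longlongrightarrow> l) at_top"
  shows "integrable M R"
proof -
  have [measurable]: "\<xi> \<in> borel_measurable M" "R \<in> borel_measurable M"
    using indep_var_rv1[OF indep] indep_var_rv2[OF indep] by auto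
  define Rn where "Rn = (\<lambda>n \<omega>. min (R \<omega>) (real n))"
  have int: "integrable M (Rn n)" for n
    by (rule integrable_const_bound[where B = "real n"]) (use R_nonneg in \<open>auto simp: Rn_def\<close>)
  have bound: "expectation (Rn n) \<le> l / c" for n
  proof -
    have "indep_var borel (id \<circ> \<xi>) borel ((\<lambda>r. min r (real n)) \<circ> R)"
      by (rule indep_var_compose[OF indep]) auto
    then have "indep_var borel \<xi> borel (Rn n)" by (simp add: comp_def Rn_def)
    then have "((\<lambda>t. t * \<P>(\<omega> in M. \<xi> \<omega> * Rn n \<omega> > t)) \<longlongrightarrow> c * expectation (Rn n)) at_top"
      by (rule breiman[OF _ tail]) (use int R_nonneg in \<open>auto simp: Rn_def\<close>)
    then have "c * expectation (Rn n) \<le> l"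
    proof (rule tendsto_le[OF _ lim, rotated])
      show "\<forall>\<^sub>F t in at_top. t * \<P>(\<omega> in M. \<xi> \<omega> * Rn n \<omega> > t) \<le> t * \<P>(\<omega> in M. \<xi> \<omega> * R \<omega> > t)"
        using eventually_gt_at_top[of 0]
      proof eventually_elim
        case (elim t)
        \<comment> \<open>\<xi> carries no sign condition here, but a product above t > 0 with a
          nonnegative factor forces \<xi> \<ge> 0, and then truncating \<open>R\<close> can only
          lower the product.\<close>
        have "t < \<xi> \<omega> * R \<omega>" if "t < \<xi> \<omega> * Rn n \<omega>" for \<omega>
        proof -
          have "0 < \<xi> \<omega> * Rn n \<omega>" using that elim by simp
          moreover have "0 \<le> Rn n \<omega>" using R_nonneg by (simp add: Rn_def)
          ultimately have "0 \<le> \<xi> \<omega>" by (auto simp: zero_less_mult_iff)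
          then have "\<xi> \<omega> * Rn n \<omega> \<le> \<xi> \<omega> * R \<omega>" by (intro mult_left_mono) (simp_all add: Rn_def)
          then show ?thesis using that by simp
        qed
        then show ?case using elim
          by (intro mult_left_mono finite_measure_mono) (auto simp: Rn_def)
      qed
    qed simp
    then show ?thesis using c by (simp add: field_simps)
  qed
  have "(\<integral>\<^sup>+\<omega>. ennreal (R \<omega>) \<partial>M) = (\<integral>\<^sup>+\<omega>. (SUP n. ennreal (Rn n \<omega>)) \<partial>M)"
  proof (rule nn_integral_cong)
    fix \<omega>
    obtain n where n: "R \<omega> \<le> real n" using real_arch_simple by blast
    show "ennreal (R \<omega>) = (SUP n. ennreal (Rn n \<omega>))"
    proof (rule antisym)
      show "ennreal (R \<omega>) \<le> (SUP n. ennreal (Rn n \<omega>))"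
        using n by (intro SUP_upper2[of n]) (auto simp: Rn_def)
    qed (auto simp: Rn_def intro!: SUP_least ennreal_leI)
  qed
  also have "\<dots> = (SUP n. \<integral>\<^sup>+\<omega>. ennreal (Rn n \<omega>) \<partial>M)"
    by (rule nn_integral_monotone_convergence_SUP)
      (auto simp: Rn_def incseq_def le_fun_def intro!: ennreal_leI)
  also have "\<dots> \<le> ennreal (l / c)"
  proof (rule SUP_least)
    fix n
    have "(\<integral>\<^sup>+\<omega>. ennreal (Rn n \<omega>) \<partial>M) = ennreal (expectation (Rn n))"
      by (rule nn_integral_eq_integral[OF int]) (use R_nonneg in \<open>auto simp: Rn_def\<close>)
    then show "(\<integral>\<^sup>+\<omega>. ennreal (Rn n \<omega>) \<partial>M) \<le> ennreal (l / c)"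
      using bound by (simp add: ennreal_leI)
  qed
  finally show ?thesis
    by (intro integrableI_nonneg) (use R_nonneg in \<open>auto simp: le_less_trans\<close>)
qed

section \<open>Quantiles and tail dependence\<close>

text \<open>A distribution function may jump at its quantile. One unit to the right there is a point
  that attains the level, one unit to the left there is none, so both bounds follow from the infimum
  alone. The unit is arbitrary and disappears for 1/t tails.\<close>

lemma (in prob_space) quantile_bounds:
  fixes \<zeta> :: "'a \<Rightarrow> real"
  assumes [measurable]: "\<zeta> \<in> borel_measurable M" and p: "0 < p" "p < 1"
  shows "\<P>(\<omega> in M. \<zeta> \<omega> > quantile M \<zeta> p + 1) \<le> 1 - p"
    and "1 - p \<le> \<P>(\<omega> in M. \<zeta> \<omega> > quantile M \<zeta> p - 1)"
    and "\<P>(\<omega> in M. \<zeta> \<omega> > x) > 1 - p \<Longrightarrow> x \<le> quantile M \<zeta> p"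
proof -
  interpret D: real_distribution "distr M borel \<zeta>" by (rule real_distribution_distr) simp
  let ?S = "{x. p \<le> cdf (distr M borel \<zeta>) x}"
  have cdf_eq: "cdf (distr M borel \<zeta>) x = 1 - \<P>(\<omega> in M. \<zeta> \<omega> > x)" for x
  proof -
    have "cdf (distr M borel \<zeta>) x = prob {\<omega> \<in> space M. \<zeta> \<omega> \<le> x}"
      unfolding cdf_def by (subst measure_distr) (auto intro!: arg_cong[where f = prob])
    also have "\<dots> = prob (space M - {\<omega> \<in> space M. \<zeta> \<omega> > x})"
      by (auto intro!: arg_cong[where f = prob])
    also have "\<dots> = 1 - \<P>(\<omega> in M. \<zeta> \<omega> > x)" by (rule prob_compl) simp
    finally show ?thesis .
  qed
  have "\<forall>\<^sub>F x in at_top. p < cdf (distr M borel \<zeta>) x"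
    using D.cdf_lim_at_top_prob p(2) by (rule order_tendstoD)
  then have ne: "?S \<noteq> {}"
    by (auto simp: eventually_at_top_linorder intro: less_imp_le)
  have "\<forall>\<^sub>F x in at_bot. cdf (distr M borel \<zeta>) x < p"
    using D.cdf_lim_at_bot p(1) by (rule order_tendstoD)
  then obtain m where m: "cdf (distr M borel \<zeta>) m < p"
    by (auto simp: eventually_at_bot_linorder)
  \<comment> \<open>Any point whose distribution function is below the level is a lower bound of
    \<open>?S\<close>. This gives both boundedness of \<open>?S\<close> and the last claim.\<close>
  have below: "x \<le> y" if "cdf (distr M borel \<zeta>) x < p" "y \<in> ?S" for x y
  proof (rule ccontr)
    assume "\<not> x \<le> y"
    then have "cdf (distr M borel \<zeta>) y \<le> cdf (distr M borel \<zeta>) x" by (intro D.cdf_nondecreasing) simp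
    then show False using that by simp
  qed
  have bdd: "bdd_below ?S" by (rule bdd_belowI[of _ m]) (rule below[OF m])
  obtain y where y: "y \<in> ?S" "y < quantile M \<zeta> p + 1"
    using cInf_lessD[OF ne, of "quantile M \<zeta> p + 1"] by (auto simp: quantile_def)
  then have "p \<le> cdf (distr M borel \<zeta>) (quantile M \<zeta> p + 1)"
    using D.cdf_nondecreasing[of y "quantile M \<zeta> p + 1"] by simp
  then show "\<P>(\<omega> in M. \<zeta> \<omega> > quantile M \<zeta> p + 1) \<le> 1 - p" by (simp add: cdf_eq)
  have "quantile M \<zeta> p - 1 \<notin> ?S"
    using cInf_lower[OF _ bdd, of "quantile M \<zeta> p - 1"] by (auto simp: quantile_def)
  then show "1 - p \<le> \<P>(\<omega> in M. \<zeta> \<omega> > quantile M \<zeta> p - 1)" by (simp add: cdf_eq)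
  show "x \<le> quantile M \<zeta> p" if "\<P>(\<omega> in M. \<zeta> \<omega> > x) > 1 - p"
    unfolding quantile_def using that by (intro cInf_greatest[OF ne] below) (simp add: cdf_eq)
qed

text \<open>The error is \<open>a * f (t + a)\<close>; writing it as the convergent factor
  \<open>(t + a) * f (t + a)\<close> times the inverse of \<open>t + a\<close> shows that it
  vanishes.\<close>

lemma tendsto_mult_shift:
  fixes f :: "real \<Rightarrow> real"
  assumes "((\<lambda>t. t * f t) \<longlongrightarrow> \<kappa>) at_top"
  shows "((\<lambda>t. t * f (t + a)) \<longlongrightarrow> \<kappa>) at_top"
proof -
  have lim: "filterlim (\<lambda>t::real. t + a) at_top at_top"
    by (subst add.commute) (rule filterlim_tendsto_add_at_top[OF tendsto_const filterlim_ident])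
  have f: "((\<lambda>t. (t + a) * f (t + a)) \<longlongrightarrow> \<kappa>) at_top"
    using filterlim_compose[OF assms lim] .
  have "((\<lambda>t. a * (((t + a) * f (t + a)) * inverse (t + a))) \<longlongrightarrow> a * (\<kappa> * 0)) at_top"
    by (intro tendsto_mult tendsto_const f tendsto_inverse_0_at_top lim)
  from tendsto_diff[OF f this]
  have "((\<lambda>t. (t + a) * f (t + a) - a * (((t + a) * f (t + a)) * inverse (t + a))) \<longlongrightarrow> \<kappa>) at_top"
    by simp
  then show ?thesis
  proof (rule Lim_transform_eventually)
    show "\<forall>\<^sub>F t in at_top. (t + a) * f (t + a) - a * (((t + a) * f (t + a)) * inverse (t + a)) = t * f (t + a)"
      using eventually_gt_at_top[of "- a"] by eventually_elim (simp add: field_simps)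
  qed
qed

text \<open>Since \<kappa> > 0, every level is exceeded with positive probability, so the quantile
  diverges. Then 1 - p is caught between the tails one unit to the right and to the left of the
  quantile, and both, multiplied by the quantile, tend to \<kappa>.\<close>

lemma (in prob_space) quantile_tail:
  fixes \<zeta> :: "'a \<Rightarrow> real"
  assumes [measurable]: "\<zeta> \<in> borel_measurable M"
    and tail: "((\<lambda>t. t * \<P>(\<omega> in M. \<zeta> \<omega> > t)) \<longlongrightarrow> \<kappa>) at_top" and \<kappa>: "0 < \<kappa>"
  shows "filterlim (quantile M \<zeta>) at_top (at_left 1)"
    and "((\<lambda>p. quantile M \<zeta> p * (1 - p)) \<longlongrightarrow> \<kappa>) (at_left 1)"
proof -
  have p01: "\<forall>\<^sub>F p in at_left (1::real). 0 < p \<and> p < 1"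
    using eventually_at_left_real[of 0 1] by simp
  have pos: "0 < \<P>(\<omega> in M. \<zeta> \<omega> > x)" for x
  proof -
    have "\<forall>\<^sub>F t in at_top. 0 < t * \<P>(\<omega> in M. \<zeta> \<omega> > t) \<and> x \<le> t \<and> 0 < t"
      by (intro eventually_conj order_tendstoD(1)[OF tail \<kappa>] eventually_ge_at_top eventually_gt_at_top)
    then obtain t where t: "0 < t * \<P>(\<omega> in M. \<zeta> \<omega> > t)" "x \<le> t" "0 < t"
      using eventually_happens'[of "at_top :: real filter"] by force
    then have "0 < \<P>(\<omega> in M. \<zeta> \<omega> > t)" by (simp add: zero_less_mult_iff)
    also have "\<dots> \<le> \<P>(\<omega> in M. \<zeta> \<omega> > x)" using t by (intro finite_measure_mono) auto
    finally show ?thesis .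
  qed
  show lim: "filterlim (quantile M \<zeta>) at_top (at_left 1)"
    unfolding filterlim_at_top
  proof
    fix x
    have "\<forall>\<^sub>F p in at_left 1. 1 - \<P>(\<omega> in M. \<zeta> \<omega> > x) < p"
      using eventually_at_left_real[of "1 - \<P>(\<omega> in M. \<zeta> \<omega> > x)" 1] pos[of x]
      by (auto elim: eventually_mono)
    with p01 show "\<forall>\<^sub>F p in at_left 1. x \<le> quantile M \<zeta> p"
      by eventually_elim (rule quantile_bounds, auto)
  qed
  show "((\<lambda>p. quantile M \<zeta> p * (1 - p)) \<longlongrightarrow> \<kappa>) (at_left 1)"
  proof (rule tendsto_sandwich)
    have ge: "\<forall>\<^sub>F p in at_left 1. 0 \<le> quantile M \<zeta> p"
      using lim by (simp add: filterlim_at_top)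
    show "\<forall>\<^sub>F p in at_left 1. quantile M \<zeta> p * \<P>(\<omega> in M. \<zeta> \<omega> > quantile M \<zeta> p + 1) \<le> quantile M \<zeta> p * (1 - p)"
      using p01 ge by eventually_elim (intro mult_left_mono quantile_bounds(1), auto)
    show "\<forall>\<^sub>F p in at_left 1. quantile M \<zeta> p * (1 - p) \<le> quantile M \<zeta> p * \<P>(\<omega> in M. \<zeta> \<omega> > quantile M \<zeta> p + (- 1))"
      using p01 ge by eventually_elim (intro mult_left_mono, auto intro: quantile_bounds(2))
  qed (rule filterlim_compose[OF tendsto_mult_shift[OF tail] lim])+
qed

text \<open>The definition uses two different thresholds, while \<open>joint\<close> knows only a
  common one. Equal marginal constants make both quantiles equivalent to \<kappa> / (1 - p), so the
  common thresholds max and min of the quantiles bracket the true event at no asymptotic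
  cost.\<close>

lemma (in prob_space) has_tail_dependenceI:
  fixes \<zeta>1 \<zeta>2 :: "'a \<Rightarrow> real"
  assumes [measurable]: "\<zeta>1 \<in> borel_measurable M" "\<zeta>2 \<in> borel_measurable M"
    and tail1: "((\<lambda>t. t * \<P>(\<omega> in M. \<zeta>1 \<omega> > t)) \<longlongrightarrow> \<kappa>) at_top"
    and tail2: "((\<lambda>t. t * \<P>(\<omega> in M. \<zeta>2 \<omega> > t)) \<longlongrightarrow> \<kappa>) at_top" and \<kappa>: "0 < \<kappa>"
    and joint: "((\<lambda>t. t * \<P>(\<omega> in M. \<zeta>1 \<omega> > t \<and> \<zeta>2 \<omega> > t)) \<longlongrightarrow> l) at_top"
  shows "has_tail_dependence M \<zeta>1 \<zeta>2 (l / \<kappa>)"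
proof -
  define q1 q2 where "q1 = quantile M \<zeta>1" and "q2 = quantile M \<zeta>2"
  define J where "J = (\<lambda>t. \<P>(\<omega> in M. \<zeta>1 \<omega> > t \<and> \<zeta>2 \<omega> > t))"
  note q1 = quantile_tail[OF _ tail1 \<kappa>, simplified, folded q1_def]
  note q2 = quantile_tail[OF _ tail2 \<kappa>, simplified, folded q2_def]
  have p1: "\<forall>\<^sub>F p in at_left (1::real). p < 1"
    using eventually_at_left_real[of 0 1] by (auto elim: eventually_mono)
  \<comment> \<open>Multiplied by 1 - p, both \<open>q2 p\<close> and \<open>m p\<close> tend to
    \<kappa>; hence their quotient tends to 1 and \<open>q2 p\<close> may replace \<open>m p\<close>
    as the normalization of \<open>J (m p)\<close>.\<close>
  have key: "((\<lambda>p. q2 p * J (m p)) \<longlongrightarrow> l) (at_left 1)"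
    if m: "m = (\<lambda>p. min (q1 p) (q2 p)) \<or> m = (\<lambda>p. max (q1 p) (q2 p))" for m
  proof -
    have m_top: "filterlim m at_top (at_left 1)"
      using that
    proof (elim disjE)
      assume "m = (\<lambda>p. min (q1 p) (q2 p))"
      then show ?thesis using q1(1) q2(1) unfolding filterlim_at_top
        by (auto intro: eventually_elim2)
    next
      assume "m = (\<lambda>p. max (q1 p) (q2 p))"
      then show ?thesis using q1(1) unfolding filterlim_at_top
        by (fastforce elim: eventually_mono intro: max.coboundedI1)
    qed
    have "((\<lambda>p. m p * (1 - p)) \<longlongrightarrow> \<kappa>) (at_left 1)"
      using that
    proof (elim disjE)
      assume m: "m = (\<lambda>p. min (q1 p) (q2 p))"
      show ?thesis
        by (rule Lim_transform_eventually[OF tendsto_min[OF q1(2) q2(2), simplified]])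
          (use p1 in eventually_elim, simp add: m min_mult_distrib_right)
    next
      assume m: "m = (\<lambda>p. max (q1 p) (q2 p))"
      show ?thesis
        by (rule Lim_transform_eventually[OF tendsto_max[OF q1(2) q2(2), simplified]])
          (use p1 in eventually_elim, simp add: m max_mult_distrib_right)
    qed
    from tendsto_mult[OF tendsto_divide[OF q2(2) this] filterlim_compose[OF joint m_top]] \<kappa>
    have "((\<lambda>p. q2 p * (1 - p) / (m p * (1 - p)) * (m p * J (m p))) \<longlongrightarrow> l) (at_left 1)"
      by (simp add: J_def)
    moreover have "\<forall>\<^sub>F p in at_left 1. 0 < m p"
      using m_top by (simp add: filterlim_at_top_dense)
    then have "\<forall>\<^sub>F p in at_left 1. q2 p * (1 - p) / (m p * (1 - p)) * (m p * J (m p)) = q2 p * J (m p)"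
      using p1 by eventually_elim simp
    ultimately show ?thesis by (rule Lim_transform_eventually)
  qed
  have q2_pos: "\<forall>\<^sub>F p in at_left 1. 0 < q2 p"
    using q2(1) by (simp add: filterlim_at_top_dense)
  have "((\<lambda>p. q2 p * \<P>(\<omega> in M. \<zeta>1 \<omega> > q1 p \<and> \<zeta>2 \<omega> > q2 p)) \<longlongrightarrow> l) (at_left 1)"
  proof (rule tendsto_sandwich[OF _ _ key key])
    show "\<forall>\<^sub>F p in at_left 1. q2 p * J (max (q1 p) (q2 p)) \<le> q2 p * \<P>(\<omega> in M. \<zeta>1 \<omega> > q1 p \<and> \<zeta>2 \<omega> > q2 p)"
      using q2_pos by eventually_elim (auto simp: J_def intro!: mult_left_mono finite_measure_mono)
    show "\<forall>\<^sub>F p in at_left 1. q2 p * \<P>(\<omega> in M. \<zeta>1 \<omega> > q1 p \<and> \<zeta>2 \<omega> > q2 p) \<le> q2 p * J (min (q1 p) (q2 p))"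
      using q2_pos by eventually_elim (auto simp: J_def intro!: mult_left_mono finite_measure_mono)
  qed auto
  from tendsto_divide[OF this filterlim_compose[OF tail2 q2(1)]] \<kappa>
  have "((\<lambda>p. q2 p * \<P>(\<omega> in M. \<zeta>1 \<omega> > q1 p \<and> \<zeta>2 \<omega> > q2 p) / (q2 p * \<P>(\<omega> in M. \<zeta>2 \<omega> > q2 p))) \<longlongrightarrow> l / \<kappa>) (at_left 1)"
    by simp
  then show ?thesis
    unfolding has_tail_dependence_def cond_prob_def q1_def[symmetric] q2_def[symmetric]
    by (rule Lim_transform_eventually) (use q2_pos in eventually_elim, simp)
qed


section \<open>The limit law as a tilted law\<close>

lemma homogeneous_zero: "homogeneous f \<Longrightarrow> f 0 = 0"
  unfolding homogeneous_def by (metis mult_zero_left order_refl scaleR_zero_left)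

section \<open>Tails of homogeneous functions of the Pareto-Breiman vector\<close>

context pareto_breiman
begin

lemma model_measurable [measurable]:
  "\<xi> \<in> borel_measurable M" "V \<in> borel_measurable M" "W \<in> borel_measurable M"
  "\<tau>X \<in> borel_measurable borel"
  using xi_measurable V_measurable W_measurable borel_measurable_continuous_onI[OF tauX_continuous]
  by auto

lemma tau_measurable [measurable]: "tau \<tau>X \<in> borel_measurable borel"
  unfolding tau_def by (intro borel_measurable_add borel_measurable_max
      measurable_compose[OF _ model_measurable(4)] borel_measurable_continuous_onI continuous_intros)

lemma tau_nonneg: "0 \<le> tau \<tau>X z"
  by (simp add: tau_def tauX_nonneg)

lemma tau_homogeneous: "homogeneous (tau \<tau>X)"
  using tauX_homogeneous
  by (auto simp: homogeneous_def tau_def distrib_left max_mult_distrib_left)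

text \<open>The preimage family of a Borel function of (V, W) is a subfamily of the one for (V, W),
  so it inherits independence from \<xi>. Both families are closed under intersection, which lifts
  independence to the generated sigma-algebras.\<close>

lemma indep_var_xi:
  fixes f :: "real \<times> (real ^ 'd) \<Rightarrow> real"
  assumes f: "f \<in> borel_measurable borel"
  shows "indep_var borel \<xi> borel (\<lambda>\<omega>. f (V \<omega>, W \<omega>))"
proof -
  have stable: "Int_stable {X -` A \<inter> space M | A. A \<in> sets borel}" for X :: "'a \<Rightarrow> 'c::topological_space"
  proof (rule Int_stableI)
    fix a b assume "a \<in> {X -` A \<inter> space M | A. A \<in> sets borel}" "b \<in> {X -` A \<inter> space M | A. A \<in> sets borel}"
    then obtain A B where "a = X -` A \<inter> space M" "b = X -` B \<inter> space M" "A \<in> sets borel" "B \<in> sets borel"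
      by auto
    then show "a \<inter> b \<in> {X -` A \<inter> space M | A. A \<in> sets borel}"
      by (intro CollectI exI[of _ "A \<inter> B"]) auto
  qed
  have mono: "indep_set A B \<Longrightarrow> C \<subseteq> B \<Longrightarrow> indep_set A C" for A B C
    unfolding indep_sets2_eq by blast
  have "{(\<lambda>\<omega>. f (V \<omega>, W \<omega>)) -` A \<inter> space M | A. A \<in> sets borel}
      \<subseteq> {(\<lambda>\<omega>. (V \<omega>, W \<omega>)) -` B \<inter> space M | B. B \<in> sets borel}"
  proof clarify
    fix A :: "real set" assume "A \<in> sets borel"
    then have "f -` A \<in> sets borel" using measurable_sets[OF f, of A] by simp
    then show "\<exists>B. (\<lambda>\<omega>. f (V \<omega>, W \<omega>)) -` A \<inter> space M = (\<lambda>\<omega>. (V \<omega>, W \<omega>)) -` B \<inter> space M \<and> B \<in> sets borel"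
      by (intro exI[of _ "f -` A"]) auto
  qed
  from mono[OF indep this]
  have "indep_set {\<xi> -` A \<inter> space M | A. A \<in> sets borel}
      {(\<lambda>\<omega>. f (V \<omega>, W \<omega>)) -` A \<inter> space M | A. A \<in> sets borel}" .
  note indep_set_sigma_sets[OF this stable stable]
  moreover have "(\<lambda>\<omega>. f (V \<omega>, W \<omega>)) \<in> borel_measurable M"
    by (rule measurable_compose[OF _ f]) measurable
  ultimately show ?thesis
    unfolding indep_var_eq using xi_measurable by blast
qed

lemma homogeneous_prob_eq:
  assumes H: "homogeneous H" "H \<in> borel_measurable borel"
  shows "\<P>(\<omega> in M. H (\<xi> \<omega> *\<^sub>R (V \<omega>, W \<omega>)) > t) = \<P>(\<omega> in M. \<xi> \<omega> * H (V \<omega>, W \<omega>) > t)"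
proof (rule prob_eq_AE)
  show "AE \<omega> in M. (t < H (\<xi> \<omega> *\<^sub>R (V \<omega>, W \<omega>))) = (t < \<xi> \<omega> * H (V \<omega>, W \<omega>))"
    using xi_nonneg
  proof eventually_elim
    case (elim \<omega>)
    then have "H (\<xi> \<omega> *\<^sub>R (V \<omega>, W \<omega>)) = \<xi> \<omega> * H (V \<omega>, W \<omega>)"
      using H(1) unfolding homogeneous_def by blast
    then show ?case by simp
  qed
  have [measurable]: "H \<in> borel_measurable borel" by fact
  show "{\<omega> \<in> space M. t < H (\<xi> \<omega> *\<^sub>R (V \<omega>, W \<omega>))} \<in> events"
    "{\<omega> \<in> space M. t < \<xi> \<omega> * H (V \<omega>, W \<omega>)} \<in> events"
    by measurable
qed

lemma homogeneous_tail:
  assumes H: "homogeneous H" "H \<in> borel_measurable borel" "\<And>z. 0 \<le> H z"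
    and int: "integrable M (\<lambda>\<omega>. H (V \<omega>, W \<omega>))"
  shows "((\<lambda>t. t * \<P>(\<omega> in M. H (\<xi> \<omega> *\<^sub>R (V \<omega>, W \<omega>)) > t)) \<longlongrightarrow>
    c\<xi> * expectation (\<lambda>\<omega>. H (V \<omega>, W \<omega>))) at_top"
  unfolding homogeneous_prob_eq[OF H(1,2)]
  by (rule breiman[OF indep_var_xi[OF H(2)] xi_tail H(3) int])

lemma homogeneous_integrable:
  assumes H: "homogeneous H" "H \<in> borel_measurable borel" "\<And>z. 0 \<le> H z"
    and lim: "((\<lambda>t. t * \<P>(\<omega> in M. H (\<xi> \<omega> *\<^sub>R (V \<omega>, W \<omega>)) > t)) \<longlongrightarrow> l) at_top"
  shows "integrable M (\<lambda>\<omega>. H (V \<omega>, W \<omega>))"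
  using lim unfolding homogeneous_prob_eq[OF H(1,2)]
  by (rule breiman_integrable[OF indep_var_xi[OF H(2)] xi_tail c_xi_pos H(3)])

lemma tau_integrable: "integrable M (\<lambda>\<omega>. tau \<tau>X (V \<omega>, W \<omega>))"
  unfolding tau_def using V_integrable tauX_W_integrable by simp

lemma tau_expectation_pos: "0 < expectation (\<lambda>\<omega>. tau \<tau>X (V \<omega>, W \<omega>))"
proof -
  have "expectation (\<lambda>\<omega>. \<tau>X (W \<omega>)) \<le> expectation (\<lambda>\<omega>. tau \<tau>X (V \<omega>, W \<omega>))"
    by (intro integral_mono tauX_W_integrable tau_integrable) (simp add: tau_def)
  then show ?thesis using tauX_W_expectation_pos by simp
qed

end

section \<open>Identification of the limit law\<close>

lemma tv_dist_upper:
  assumes "prob_space \<mu>" "prob_space \<nu>" "A \<in> sets \<nu>"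
  shows "\<bar>measure \<mu> A - measure \<nu> A\<bar> \<le> tv_dist \<mu> \<nu>"
  unfolding tv_dist_def
proof (rule cSUP_upper[OF assms(3)])
  have "\<bar>measure \<mu> B - measure \<nu> B\<bar> \<le> 1" for B
    using prob_space.prob_le_1[OF assms(1), of B] prob_space.prob_le_1[OF assms(2), of B]
      measure_nonneg[of \<mu> B] measure_nonneg[of \<nu> B] by linarith
  then show "bdd_above ((\<lambda>B. \<bar>measure \<mu> B - measure \<nu> B\<bar>) ` sets \<nu>)"
    by (intro bdd_aboveI[of _ 1]) auto
qed

context pareto_breiman_limit
begin

lemma prob_ThetaZ:
  assumes A [measurable]: "A \<in> sets borel"
  shows "expectation (\<lambda>\<omega>. tau \<tau>X (V \<omega>, W \<omega>)) * measure (distr N borel \<Theta>Z) A =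
    expectation (\<lambda>\<omega>. tau \<tau>X (V \<omega>, W \<omega>) * indicator A ((V \<omega>, W \<omega>) /\<^sub>R tau \<tau>X (V \<omega>, W \<omega>)))"
proof -
  define Z where "Z \<omega> = \<xi> \<omega> *\<^sub>R (V \<omega>, W \<omega>)" for \<omega>
  have Z [measurable]: "Z \<in> borel_measurable M" unfolding Z_def by measurable
  \<comment> \<open>The direction \<open>z /\<^sub>R tau \<tau>X z\<close> is invariant under
    positive scaling, so \<open>H\<close> is homogeneous; the factor \<open>tau \<tau>X z\<close>
    makes it 0 where the direction is meaningless.\<close>
  define H where "H z = tau \<tau>X z * indicator A (z /\<^sub>R tau \<tau>X z)" for z
  have H_meas [measurable]: "H \<in> borel_measurable borel"
    unfolding H_def by measurable
  have H_hom: "homogeneous H"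
    unfolding homogeneous_def
  proof (intro allI impI)
    fix c :: real and z :: "real \<times> (real ^ 'd)" assume c: "0 \<le> c"
    have tau_eq: "tau \<tau>X (c *\<^sub>R z) = c * tau \<tau>X z"
      using tau_homogeneous c unfolding homogeneous_def by blast
    show "H (c *\<^sub>R z) = c * H z"
    proof (cases "c = 0")
      case False
      then have "inverse (c * tau \<tau>X z) * c = inverse (tau \<tau>X z)"
        by (simp add: inverse_mult_distrib)
      then have "(c *\<^sub>R z) /\<^sub>R tau \<tau>X (c *\<^sub>R z) = z /\<^sub>R tau \<tau>X z"
        by (simp only: tau_eq scaleR_scaleR)
      then show ?thesis by (simp only: H_def tau_eq mult.assoc)
    qed (simp add: H_def homogeneous_zero[OF tau_homogeneous])
  qed
  let ?R = "\<lambda>\<omega>. tau \<tau>X (V \<omega>, W \<omega>)"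
  have H_int: "integrable M (\<lambda>\<omega>. H (V \<omega>, W \<omega>))"
    by (rule Bochner_Integration.integrable_bound[OF tau_integrable])
      (auto simp: H_def tau_nonneg indicator_def)
  have tail_H: "((\<lambda>t. t * \<P>(\<omega> in M. H (Z \<omega>) > t)) \<longlongrightarrow> c\<xi> * expectation (\<lambda>\<omega>. H (V \<omega>, W \<omega>))) at_top"
    unfolding Z_def
    by (rule homogeneous_tail[OF H_hom H_meas _ H_int]) (simp add: H_def tau_nonneg)
  have tail: "((\<lambda>t. t * \<P>(\<omega> in M. tau \<tau>X (Z \<omega>) > t)) \<longlongrightarrow> c\<xi> * expectation ?R) at_top"
    unfolding Z_def
    by (rule homogeneous_tail[OF tau_homogeneous tau_measurable tau_nonneg tau_integrable])
  have pos: "0 < c\<xi> * expectation ?R" using c_xi_pos tau_expectation_pos by simp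
  define \<mu> where "\<mu> t = cond_law M (\<lambda>\<omega>. tau \<tau>X (Z \<omega>) > t) (\<lambda>\<omega>. Z \<omega> /\<^sub>R tau \<tau>X (Z \<omega>))" for t
  \<comment> \<open>The conditional law is a probability measure only if the conditioning event has
    positive probability; the positive tail constant ensures this for large t.\<close>
  have ev: "\<forall>\<^sub>F t in at_top. 0 < t \<and> 0 < \<P>(\<omega> in M. tau \<tau>X (Z \<omega>) > t)"
    using order_tendstoD(1)[OF tail pos] eventually_gt_at_top[of 0]
    by eventually_elim (auto simp: zero_less_mult_iff)
  have meas: "measure (\<mu> t) A = \<P>(\<omega> in M. H (Z \<omega>) > t) / \<P>(\<omega> in M. tau \<tau>X (Z \<omega>) > t)"
    if t: "0 < t" and p: "0 < \<P>(\<omega> in M. tau \<tau>X (Z \<omega>) > t)" for t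
  proof -
    let ?E = "{\<omega> \<in> space M. tau \<tau>X (Z \<omega>) > t}"
    have "measure (\<mu> t) A = measure (uniform_measure M ?E)
        ((\<lambda>\<omega>. Z \<omega> /\<^sub>R tau \<tau>X (Z \<omega>)) -` A \<inter> space (uniform_measure M ?E))"
      unfolding \<mu>_def cond_law_def by (rule measure_distr) measurable
    also have "\<dots> = prob (?E \<inter> ((\<lambda>\<omega>. Z \<omega> /\<^sub>R tau \<tau>X (Z \<omega>)) -` A \<inter> space M)) / prob ?E"
      by (subst measure_uniform_measure) (use p in \<open>auto simp: emeasure_eq_measure\<close>)
    \<comment> \<open>For t > 0, exceeding t forces the indicator in \<open>H\<close> to be 1, so a
      single exceedance encodes both the radius and the direction. The conditional probability is
      thus a quotient of two Breiman tails.\<close>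
    also have "?E \<inter> ((\<lambda>\<omega>. Z \<omega> /\<^sub>R tau \<tau>X (Z \<omega>)) -` A \<inter> space M) = {\<omega> \<in> space M. H (Z \<omega>) > t}"
      using t by (auto simp: H_def indicator_def split: if_splits)
    finally show ?thesis .
  qed
  have "((\<lambda>t. measure (\<mu> t) A) \<longlongrightarrow> c\<xi> * expectation (\<lambda>\<omega>. H (V \<omega>, W \<omega>)) / (c\<xi> * expectation ?R)) at_top"
    using pos ev
    by (intro Lim_transform_eventually[OF tendsto_divide[OF tail_H tail]])
      (auto simp: meas elim!: eventually_mono)
  moreover have "((\<lambda>t. measure (\<mu> t) A) \<longlongrightarrow> measure (distr N borel \<Theta>Z) A) at_top"
  proof (subst Lim_null, rule Lim_null_comparison)
    show "\<forall>\<^sub>F t in at_top. norm (measure (\<mu> t) A - measure (distr N borel \<Theta>Z) A) \<le> tv_dist (\<mu> t) (distr N borel \<Theta>Z)"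
      using ev
    proof eventually_elim
      case (elim t)
      have "prob_space (uniform_measure M {\<omega> \<in> space M. tau \<tau>X (Z \<omega>) > t})"
        by (rule prob_space_uniform_measure) (use elim in \<open>auto simp: emeasure_eq_measure\<close>)
      then have "prob_space (\<mu> t)"
        unfolding \<mu>_def cond_law_def by (rule prob_space.prob_space_distr) measurable
      moreover have "prob_space (distr N borel \<Theta>Z)"
        by (rule N.prob_space_distr) (rule ThetaZ_measurable)
      ultimately show ?case
        unfolding real_norm_def by (rule tv_dist_upper) simp
    qed
    show "((\<lambda>t. tv_dist (\<mu> t) (distr N borel \<Theta>Z)) \<longlongrightarrow> 0) at_top"
      using limit_law unfolding \<mu>_def Z_def .
  qed
  ultimately have "measure (distr N borel \<Theta>Z) A =
      c\<xi> * expectation (\<lambda>\<omega>. H (V \<omega>, W \<omega>)) / (c\<xi> * expectation ?R)"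
    by (intro tendsto_unique[of at_top]) auto
  then show ?thesis
    using c_xi_pos tau_expectation_pos by (simp add: H_def)
qed

lemma distr_ThetaZ:
  defines "r \<equiv> \<lambda>\<omega>. tau \<tau>X (V \<omega>, W \<omega>)"
  shows "distr N borel \<Theta>Z =
    distr (density M (\<lambda>\<omega>. ennreal (r \<omega> / expectation r))) borel (\<lambda>\<omega>. (V \<omega>, W \<omega>) /\<^sub>R r \<omega>)"
proof (rule measure_eqI)
  interpret D: prob_space "distr N borel \<Theta>Z"
    by (rule N.prob_space_distr) (rule ThetaZ_measurable)
  have [measurable]: "r \<in> borel_measurable M" unfolding r_def by measurable
  have r_pos: "0 < expectation r" using tau_expectation_pos by (simp add: r_def)
  have r_eq: "tau \<tau>X (V \<omega>, W \<omega>) = r \<omega>" for \<omega> by (simp add: r_def)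
  fix A assume "A \<in> sets (distr N borel \<Theta>Z)"
  then have A [measurable]: "A \<in> sets borel" by simp
  have "emeasure (distr (density M (\<lambda>\<omega>. ennreal (r \<omega> / expectation r))) borel (\<lambda>\<omega>. (V \<omega>, W \<omega>) /\<^sub>R r \<omega>)) A
      = (\<integral>\<^sup>+\<omega>. ennreal (r \<omega> * indicator A ((V \<omega>, W \<omega>) /\<^sub>R r \<omega>) / expectation r) \<partial>M)"
    by (subst emeasure_distr, measurable, subst emeasure_density, measurable)
      (auto intro!: nn_integral_cong split: split_indicator)
  also have "\<dots> = ennreal (expectation (\<lambda>\<omega>. r \<omega> * indicator A ((V \<omega>, W \<omega>) /\<^sub>R r \<omega>) / expectation r))"
  proof (rule nn_integral_eq_integral)
    show "integrable M (\<lambda>\<omega>. r \<omega> * indicator A ((V \<omega>, W \<omega>) /\<^sub>R r \<omega>) / expectation r)"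
      by (rule integrable_divide, rule Bochner_Integration.integrable_bound[OF tau_integrable[folded r_def]])
        (auto simp: indicator_def)
  qed (use r_pos in \<open>auto simp: r_def tau_nonneg\<close>)
  also have "\<dots> = ennreal (measure (distr N borel \<Theta>Z) A)"
  proof -
    have "expectation (\<lambda>\<omega>. r \<omega> * indicator A ((V \<omega>, W \<omega>) /\<^sub>R r \<omega>)) / expectation r = measure (distr N borel \<Theta>Z) A"
      using r_pos unfolding prob_ThetaZ[OF A, unfolded r_eq, symmetric] by simp
    then show ?thesis by simp
  qed
  finally show "emeasure (distr N borel \<Theta>Z) A = emeasure (distr (density M (\<lambda>\<omega>. ennreal (r \<omega> / expectation r)))
      borel (\<lambda>\<omega>. (V \<omega>, W \<omega>) /\<^sub>R r \<omega>)) A"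
    by (simp add: D.emeasure_eq_measure)
qed simp

section \<open>Moments of homogeneous functions under the limit law\<close>

context
  fixes H :: "real \<times> (real ^ 'd) \<Rightarrow> real"
  assumes H_hom: "homogeneous H" and H_meas [measurable]: "H \<in> borel_measurable borel"
    and H_nonneg: "\<And>z. 0 \<le> H z" and H_zero: "\<And>z. tau \<tau>X z = 0 \<Longrightarrow> H z = 0"
begin

text \<open>The density \<open>r \<omega>\<close> undoes the normalization by
  \<open>r \<omega>\<close>, by homogeneity. Stated in the extended half-line, so that finiteness
  can be transferred in both directions.\<close>

lemma nn_integral_homogeneous:
  "(\<integral>\<^sup>+\<omega>. H (V \<omega>, W \<omega>) \<partial>M) = ennreal (expectation (\<lambda>\<omega>. tau \<tau>X (V \<omega>, W \<omega>))) * (\<integral>\<^sup>+\<omega>. H (\<Theta>Z \<omega>) \<partial>N)"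
proof -
  define r where "r = (\<lambda>\<omega>. tau \<tau>X (V \<omega>, W \<omega>))"
  have [measurable]: "r \<in> borel_measurable M" unfolding r_def by measurable
  have r_pos: "0 < expectation r" using tau_expectation_pos by (simp add: r_def)
  have r_eq: "tau \<tau>X (V \<omega>, W \<omega>) = r \<omega>" for \<omega> by (simp add: r_def)
  have r_nonneg: "0 \<le> r \<omega>" for \<omega> by (simp add: r_def tau_nonneg)
  \<comment> \<open>At \<open>r \<omega> = 0\<close> the left side is 0 because of its first factor;
    this is where \<open>H_zero\<close> enters.\<close>
  have H_r: "r \<omega> * H ((V \<omega>, W \<omega>) /\<^sub>R r \<omega>) = H (V \<omega>, W \<omega>)" for \<omega>
  proof (cases "r \<omega> = 0")
    case True
    then show ?thesis using H_zero by (simp add: r_def)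
  next
    case False
    have "H (inverse (r \<omega>) *\<^sub>R (V \<omega>, W \<omega>)) = inverse (r \<omega>) * H (V \<omega>, W \<omega>)"
      using H_hom r_nonneg[of \<omega>] unfolding homogeneous_def by (metis inverse_nonnegative_iff_nonnegative)
    then show ?thesis using False by simp
  qed
  have "(\<integral>\<^sup>+\<omega>. H (\<Theta>Z \<omega>) \<partial>N) = (\<integral>\<^sup>+z. H z \<partial>distr N borel \<Theta>Z)"
    by (subst nn_integral_distr) (use ThetaZ_measurable in auto)
  also have "\<dots> = (\<integral>\<^sup>+\<omega>. ennreal (r \<omega> / expectation r) * ennreal (H ((V \<omega>, W \<omega>) /\<^sub>R r \<omega>)) \<partial>M)"
    unfolding distr_ThetaZ r_eq
    by (subst nn_integral_distr, measurable) (rule nn_integral_density, measurable)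
  also have "\<dots> = (\<integral>\<^sup>+\<omega>. ennreal (inverse (expectation r)) * ennreal (H (V \<omega>, W \<omega>)) \<partial>M)"
  proof (rule nn_integral_cong)
    fix \<omega>
    have "r \<omega> / expectation r * H ((V \<omega>, W \<omega>) /\<^sub>R r \<omega>) = inverse (expectation r) * H (V \<omega>, W \<omega>)"
      unfolding H_r[symmetric] by (simp add: field_simps)
    then show "ennreal (r \<omega> / expectation r) * ennreal (H ((V \<omega>, W \<omega>) /\<^sub>R r \<omega>)) =
        ennreal (inverse (expectation r)) * ennreal (H (V \<omega>, W \<omega>))"
      using r_pos r_nonneg H_nonneg by (simp flip: ennreal_mult)
  qed
  also have "\<dots> = ennreal (inverse (expectation r)) * (\<integral>\<^sup>+\<omega>. H (V \<omega>, W \<omega>) \<partial>M)"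
    by (rule nn_integral_cmult) measurable
  finally show ?thesis
    unfolding r_eq using r_pos
    by (simp add: mult.assoc[symmetric] flip: ennreal_mult)
qed

lemma integrable_homogeneous_iff:
  "integrable M (\<lambda>\<omega>. H (V \<omega>, W \<omega>)) \<longleftrightarrow> integrable N (\<lambda>\<omega>. H (\<Theta>Z \<omega>))"
proof -
  have [measurable]: "\<Theta>Z \<in> borel_measurable N" by (rule ThetaZ_measurable)
  have "ennreal c * x < \<top> \<longleftrightarrow> x < \<top>" if "0 < c" for c x
    using that by (auto simp: ennreal_mult_less_top)
  then show ?thesis
    using tau_expectation_pos H_nonneg nn_integral_homogeneous
    by (simp add: integrable_iff_bounded)
qed

lemma expectation_homogeneous:
  "expectation (\<lambda>\<omega>. H (V \<omega>, W \<omega>)) =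
    expectation (\<lambda>\<omega>. tau \<tau>X (V \<omega>, W \<omega>)) * N.expectation (\<lambda>\<omega>. H (\<Theta>Z \<omega>))"
proof -
  have [measurable]: "\<Theta>Z \<in> borel_measurable N" by (rule ThetaZ_measurable)
  show ?thesis
    using tau_expectation_pos H_nonneg nn_integral_homogeneous
    by (simp add: integral_eq_nn_integral enn2real_mult)
qed

end

lemma U_measurable [measurable]: "U \<in> borel_measurable N"
proof -
  have "(\<lambda>\<omega>. fst (\<Theta>Z \<omega>)) \<in> borel_measurable N"
    using ThetaZ_measurable by (rule measurable_compose) (intro borel_measurable_continuous_onI continuous_intros)
  then show ?thesis by (subst measurable_cong[OF U_eq])
qed

lemma tauX_Theta: "\<omega> \<in> space N \<Longrightarrow> \<tau>X (\<Theta> \<omega>) = 1"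
  using measurable_space[OF Theta_measurable] by (auto simp: space_restrict_space)

lemma U_integrable: "integrable N U"
  by (rule N.integrable_const_bound[where B = 1]) (use U_range in \<open>auto intro!: AE_I2\<close>)

text \<open>The homogeneous function behind Y is the positive part of the first coordinate: it is
  nonnegative everywhere, vanishes where \<tau> does, and equals V almost surely. Positivity of E U
  is inherited from E V > 0.\<close>

lemma
  shows Y_tail: "((\<lambda>t. t * \<P>(\<omega> in M. \<xi> \<omega> * V \<omega> > t)) \<longlongrightarrow>
      c\<xi> * (expectation (\<lambda>\<omega>. tau \<tau>X (V \<omega>, W \<omega>)) * N.expectation U)) at_top"
    and U_expectation_pos: "0 < N.expectation U"
proof -
  let ?H = "\<lambda>z :: real \<times> (real ^ 'd). max 0 (fst z)"
  have H: "homogeneous ?H" "?H \<in> borel_measurable borel" "\<And>z. 0 \<le> ?H z" "\<And>z. tau \<tau>X z = 0 \<Longrightarrow> ?H z = 0"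
  proof -
    show "?H z = 0" if "tau \<tau>X z = 0" for z
      using that tauX_nonneg[of "snd z"] by (simp add: tau_def)
    show "?H \<in> borel_measurable borel"
      by (intro borel_measurable_continuous_onI continuous_intros)
  qed (auto simp: homogeneous_def max_mult_distrib_left)
  have "expectation V = expectation (\<lambda>\<omega>. ?H (V \<omega>, W \<omega>))"
    by (intro integral_cong_AE) (use V_nonneg in auto)
  also have "\<dots> = expectation (\<lambda>\<omega>. tau \<tau>X (V \<omega>, W \<omega>)) * N.expectation (\<lambda>\<omega>. ?H (\<Theta>Z \<omega>))"
    by (rule expectation_homogeneous[OF H])
  also have "N.expectation (\<lambda>\<omega>. ?H (\<Theta>Z \<omega>)) = N.expectation U"
    using U_range by (intro Bochner_Integration.integral_cong) (auto simp flip: U_eq)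
  finally have EV: "expectation V = expectation (\<lambda>\<omega>. tau \<tau>X (V \<omega>, W \<omega>)) * N.expectation U" .
  then show "0 < N.expectation U"
    using V_expectation_pos tau_expectation_pos by (simp add: zero_less_mult_iff)
  have "((\<lambda>t. t * \<P>(\<omega> in M. \<xi> \<omega> * max 0 (V \<omega>) > t)) \<longlongrightarrow> c\<xi> * expectation (\<lambda>\<omega>. max 0 (V \<omega>))) at_top"
    by (rule breiman[OF _ xi_tail]) (use indep_var_xi[OF H(2)] V_integrable in auto)
  moreover have "\<P>(\<omega> in M. \<xi> \<omega> * max 0 (V \<omega>) > t) = \<P>(\<omega> in M. \<xi> \<omega> * V \<omega> > t)" for t
    by (rule prob_eq_AE) (use V_nonneg in auto)
  moreover have "expectation (\<lambda>\<omega>. max 0 (V \<omega>)) = expectation V"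
    by (intro integral_cong_AE) (use V_nonneg in auto)
  ultimately show "((\<lambda>t. t * \<P>(\<omega> in M. \<xi> \<omega> * V \<omega> > t)) \<longlongrightarrow>
      c\<xi> * (expectation (\<lambda>\<omega>. tau \<tau>X (V \<omega>, W \<omega>)) * N.expectation U)) at_top"
    by (simp add: EV)
qed

section \<open>Tails of \<open>h (X)\<close> and its joint tail with Y\<close>

context
  fixes h :: "real ^ 'd \<Rightarrow> real"
  assumes h_hom: "homogeneous h" and h_meas [measurable]: "h \<in> borel_measurable borel"
    and h_nonneg: "\<And>x. 0 \<le> h x" and h_supp: "\<And>x. \<tau>X x = 0 \<Longrightarrow> h x = 0"
begin

text \<open>Where U < 1 this is homogeneity. Where U = 1, the constraint \<tau> = 1 leaves
  \<open>\<tau>X\<close> of the second component equal to 0, so \<open>h\<close> vanishes by its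
  support condition and matches the factor 1 - U = 0.\<close>

lemma h_ThetaZ:
  assumes \<omega>: "\<omega> \<in> space N"
  shows "h (snd (\<Theta>Z \<omega>)) = (1 - U \<omega>) * h (\<Theta> \<omega>)"
proof (cases "U \<omega> < 1")
  case True
  then show ?thesis using Theta_eq[OF \<omega>] h_hom by (simp add: homogeneous_def)
next
  case False
  then have "U \<omega> = 1" using U_range[OF \<omega>] by simp
  moreover have "\<tau>X (snd (\<Theta>Z \<omega>)) = 0"
    using tau_ThetaZ[OF \<omega>] \<open>U \<omega> = 1\<close> U_eq[OF \<omega>] by (simp add: tau_def)
  ultimately show ?thesis using h_supp by simp
qed

lemma h_snd:
  shows "homogeneous (\<lambda>z :: real \<times> (real ^ 'd). h (snd z))"
    and "(\<lambda>z :: real \<times> (real ^ 'd). h (snd z)) \<in> borel_measurable borel"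
    and "tau \<tau>X z = 0 \<Longrightarrow> h (snd z) = 0"
proof -
  show "homogeneous (\<lambda>z :: real \<times> (real ^ 'd). h (snd z))"
    using h_hom by (auto simp: homogeneous_def)
  show "(\<lambda>z :: real \<times> (real ^ 'd). h (snd z)) \<in> borel_measurable borel"
    by (rule measurable_compose[OF _ h_meas]) (intro borel_measurable_continuous_onI continuous_intros)
  show "h (snd z) = 0" if "tau \<tau>X z = 0"
    using that tauX_nonneg[of "snd z"] by (intro h_supp) (simp add: tau_def max_def split: if_splits)
qed

lemma integrable_h_iff:
  "integrable M (\<lambda>\<omega>. h (W \<omega>)) \<longleftrightarrow> integrable N (\<lambda>\<omega>. (1 - U \<omega>) * h (\<Theta> \<omega>))"
proof -
  have "integrable M (\<lambda>\<omega>. h (W \<omega>)) \<longleftrightarrow> integrable N (\<lambda>\<omega>. h (snd (\<Theta>Z \<omega>)))"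
    using integrable_homogeneous_iff[OF h_snd(1,2) h_nonneg h_snd(3)] by simp
  also have "\<dots> \<longleftrightarrow> integrable N (\<lambda>\<omega>. (1 - U \<omega>) * h (\<Theta> \<omega>))"
    by (rule Bochner_Integration.integrable_cong[OF refl h_ThetaZ])
  finally show ?thesis .
qed

text \<open>Part (ii) prescribes only a tail for \<open>h (X)\<close>; the converse of Breiman's
  lemma extracts the moment from it.\<close>

lemma integrable_h:
  assumes "((\<lambda>t. t * \<P>(\<omega> in M. h (\<xi> \<omega> *\<^sub>R W \<omega>) > t)) \<longlongrightarrow> l) at_top"
  shows "integrable M (\<lambda>\<omega>. h (W \<omega>))"
  using homogeneous_integrable[OF h_snd(1,2) h_nonneg, of l] assms by simp

lemma h_tail:
  assumes "integrable M (\<lambda>\<omega>. h (W \<omega>))"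
  shows "((\<lambda>t. t * \<P>(\<omega> in M. h (\<xi> \<omega> *\<^sub>R W \<omega>) > t)) \<longlongrightarrow>
    c\<xi> * (expectation (\<lambda>\<omega>. tau \<tau>X (V \<omega>, W \<omega>)) * C_fun N U \<Theta> h)) at_top"
proof -
  have "N.expectation (\<lambda>\<omega>. h (snd (\<Theta>Z \<omega>))) = C_fun N U \<Theta> h"
    unfolding C_fun_def by (intro Bochner_Integration.integral_cong h_ThetaZ refl)
  then have "expectation (\<lambda>\<omega>. h (W \<omega>)) = expectation (\<lambda>\<omega>. tau \<tau>X (V \<omega>, W \<omega>)) * C_fun N U \<Theta> h"
    using expectation_homogeneous[OF h_snd(1,2) h_nonneg h_snd(3)] by simp
  then show ?thesis
    using homogeneous_tail[OF h_snd(1,2) h_nonneg] assms by simp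
qed

lemma joint_tail:
  "((\<lambda>t. t * \<P>(\<omega> in M. \<xi> \<omega> * V \<omega> > t \<and> h (\<xi> \<omega> *\<^sub>R W \<omega>) > t)) \<longlongrightarrow>
    c\<xi> * (expectation (\<lambda>\<omega>. tau \<tau>X (V \<omega>, W \<omega>)) * (N.expectation U * Lambda N U \<Theta> h))) at_top"
proof -
  \<comment> \<open>Joint exceedance of t is exceedance of t by the minimum, and for t > 0 clipping
    the first coordinate at 0 changes nothing.\<close>
  let ?H = "\<lambda>z :: real \<times> (real ^ 'd). min (max 0 (fst z)) (h (snd z))"
  have [measurable]: "(\<lambda>z :: real \<times> (real ^ 'd). h (snd z)) \<in> borel_measurable borel" by (rule h_snd)
  have H: "homogeneous ?H" "?H \<in> borel_measurable borel" "\<And>z. 0 \<le> ?H z" "\<And>z. tau \<tau>X z = 0 \<Longrightarrow> ?H z = 0"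
  proof -
    show "?H z = 0" if "tau \<tau>X z = 0" for z
      using h_snd(3)[OF that] by simp
    show "homogeneous ?H"
      using h_hom by (auto simp: homogeneous_def max_mult_distrib_left min_mult_distrib_left)
    have [measurable]: "(\<lambda>z :: real \<times> (real ^ 'd). max 0 (fst z)) \<in> borel_measurable borel"
      by (intro borel_measurable_continuous_onI continuous_intros)
    show "?H \<in> borel_measurable borel" by measurable
  qed (auto simp: h_nonneg)
  \<comment> \<open>The minimum is at most |V|, whatever the size of h(W).\<close>
  have int: "integrable M (\<lambda>\<omega>. ?H (V \<omega>, W \<omega>))"
    by (rule Bochner_Integration.integrable_bound[OF V_integrable])
      (use h_nonneg in \<open>auto simp: min_def max_def\<close>)
  have "N.expectation (\<lambda>\<omega>. ?H (\<Theta>Z \<omega>)) = N.expectation (\<lambda>\<omega>. min (U \<omega>) ((1 - U \<omega>) * h (\<Theta> \<omega>)))"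
    using U_range by (intro Bochner_Integration.integral_cong refl) (auto simp: h_ThetaZ simp flip: U_eq)
  also have "\<dots> = N.expectation U * Lambda N U \<Theta> h"
    using U_expectation_pos by (simp add: Lambda_def)
  finally have E: "expectation (\<lambda>\<omega>. ?H (V \<omega>, W \<omega>)) =
      expectation (\<lambda>\<omega>. tau \<tau>X (V \<omega>, W \<omega>)) * (N.expectation U * Lambda N U \<Theta> h)"
    using expectation_homogeneous[OF H] by simp
  have "((\<lambda>t. t * \<P>(\<omega> in M. ?H (\<xi> \<omega> *\<^sub>R (V \<omega>, W \<omega>)) > t)) \<longlongrightarrow> c\<xi> * expectation (\<lambda>\<omega>. ?H (V \<omega>, W \<omega>))) at_top"
    by (rule homogeneous_tail[OF H(1-3) int])
  then show ?thesis
    unfolding E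
  proof (rule Lim_transform_eventually)
    show "\<forall>\<^sub>F t in at_top. t * \<P>(\<omega> in M. ?H (\<xi> \<omega> *\<^sub>R (V \<omega>, W \<omega>)) > t) =
        t * \<P>(\<omega> in M. \<xi> \<omega> * V \<omega> > t \<and> h (\<xi> \<omega> *\<^sub>R W \<omega>) > t)"
      using eventually_gt_at_top[of 0]
      by eventually_elim (auto intro!: arg_cong[where f = prob])
  qed
qed

text \<open>The constraint \<open>C_fun N U \<Theta> h = N.expectation U\<close> gives both margins
  the same constant; the factor E U in the joint tail then cancels and leaves exactly
  \<Lambda>(h).\<close>

lemma tail_dependence_h:
  assumes "integrable M (\<lambda>\<omega>. h (W \<omega>))" and "C_fun N U \<Theta> h = N.expectation U"
  shows "has_tail_dependence M (\<lambda>\<omega>. \<xi> \<omega> * V \<omega>) (\<lambda>\<omega>. h (\<xi> \<omega> *\<^sub>R W \<omega>)) (Lambda N U \<Theta> h)"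
    and "((\<lambda>t. \<P>(\<omega> in M. \<xi> \<omega> * V \<omega> > t \<bar> h (\<xi> \<omega> *\<^sub>R W \<omega>) > t)) \<longlongrightarrow> Lambda N U \<Theta> h) at_top"
proof -
  let ?\<kappa> = "c\<xi> * (expectation (\<lambda>\<omega>. tau \<tau>X (V \<omega>, W \<omega>)) * N.expectation U)"
  have pos: "0 < ?\<kappa>" using c_xi_pos tau_expectation_pos U_expectation_pos by simp
  note tail = h_tail[OF assms(1), unfolded assms(2)]
  have quot: "c\<xi> * (expectation (\<lambda>\<omega>. tau \<tau>X (V \<omega>, W \<omega>)) * (N.expectation U * Lambda N U \<Theta> h)) / ?\<kappa> = Lambda N U \<Theta> h"
    using pos by (auto simp: field_simps)
  show "has_tail_dependence M (\<lambda>\<omega>. \<xi> \<omega> * V \<omega>) (\<lambda>\<omega>. h (\<xi> \<omega> *\<^sub>R W \<omega>)) (Lambda N U \<Theta> h)"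
    using has_tail_dependenceI[OF _ _ Y_tail tail pos joint_tail] unfolding quot by simp
  have "((\<lambda>t. t * \<P>(\<omega> in M. \<xi> \<omega> * V \<omega> > t \<and> h (\<xi> \<omega> *\<^sub>R W \<omega>) > t) / (t * \<P>(\<omega> in M. h (\<xi> \<omega> *\<^sub>R W \<omega>) > t)))
      \<longlongrightarrow> Lambda N U \<Theta> h) at_top"
    using tendsto_divide[OF joint_tail tail less_imp_neq[OF pos, symmetric]] unfolding quot .
  then show "((\<lambda>t. \<P>(\<omega> in M. \<xi> \<omega> * V \<omega> > t \<bar> h (\<xi> \<omega> *\<^sub>R W \<omega>) > t)) \<longlongrightarrow> Lambda N U \<Theta> h) at_top"
    unfolding cond_prob_def
    by (rule Lim_transform_eventually) (use eventually_gt_at_top[of 0] in eventually_elim, simp)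
qed

end

end


section \<open>Disintegration of \<open>(U, \<Theta>)\<close>\<close>

text \<open>The defining identity on rectangles says that the law of U on the event \<Theta> \<in> B
  is the mixture of the kernel \<open>p\<close> over the law of \<Theta> restricted to B. As an
  equality of measures it integrates every \<open>\<phi>\<close> at once.\<close>

lemma regular_cond_law_nn_integral:
  assumes N: "prob_space N" and U [measurable]: "U \<in> borel_measurable N"
    and \<Theta> [measurable]: "\<Theta> \<in> measurable N S"
    and p: "regular_cond_law N U S \<Theta> p"
    and B [measurable]: "B \<in> sets S" and \<phi> [measurable]: "\<phi> \<in> borel_measurable borel"
  shows "(\<integral>\<^sup>+\<omega>. \<phi> (U \<omega>) * indicator B (\<Theta> \<omega>) \<partial>N) =
    (\<integral>\<^sup>+\<theta>. (\<integral>\<^sup>+u. \<phi> u \<partial>p \<theta>) * indicator B \<theta> \<partial>distr N S \<Theta>)"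
proof -
  interpret N: prob_space N by fact
  have p_prob: "p \<in> measurable S (prob_algebra borel)"
    using p by (simp add: regular_cond_law_def)
  then have p_meas [measurable]: "p \<in> measurable S (subprob_algebra borel)"
    by (rule measurable_prob_algebraD)
  let ?L = "density N (\<lambda>\<omega>. indicator B (\<Theta> \<omega>))" and ?R = "density (distr N S \<Theta>) (indicator B)"
  have p_R: "p \<in> measurable ?R (subprob_algebra borel)"
    using p_meas by simp
  have ne: "space ?R \<noteq> {}"
    using N.not_empty measurable_space[OF \<Theta>] by auto
  have "distr ?L borel U = ?R \<bind> p"
  proof (rule measure_eqI)
    show "sets (distr ?L borel U) = sets (?R \<bind> p)"
      using sets_bind[OF sets_kernel[OF p_R] ne] by simp
    fix A assume "A \<in> sets (distr ?L borel U)"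
    then have A [measurable]: "A \<in> sets borel" by simp
    have "emeasure (distr ?L borel U) A = (\<integral>\<^sup>+\<omega>. indicator {\<omega> \<in> space N. U \<omega> \<in> A \<and> \<Theta> \<omega> \<in> B} \<omega> \<partial>N)"
      by (subst emeasure_distr, measurable, subst emeasure_density, measurable)
        (rule nn_integral_cong, simp split: split_indicator)
    also have "\<dots> = emeasure N {\<omega> \<in> space N. U \<omega> \<in> A \<and> \<Theta> \<omega> \<in> B}"
      by (rule nn_integral_indicator) measurable
    also have "\<dots> = (\<integral>\<^sup>+\<theta>\<in>B. emeasure (p \<theta>) A \<partial>distr N S \<Theta>)"
      using p A B by (simp add: regular_cond_law_def)
    also have "\<dots> = (\<integral>\<^sup>+\<theta>. emeasure (p \<theta>) A \<partial>?R)"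
      by (subst nn_integral_density) (auto simp: mult.commute intro!: measurable_emeasure_kernel[OF p_meas])
    also have "\<dots> = emeasure (?R \<bind> p) A"
      by (rule emeasure_bind[OF ne p_R A, symmetric])
    finally show "emeasure (distr ?L borel U) A = emeasure (?R \<bind> p) A" .
  qed
  then have "(\<integral>\<^sup>+u. \<phi> u \<partial>distr ?L borel U) = (\<integral>\<^sup>+u. \<phi> u \<partial>(?R \<bind> p))" by simp
  also have "\<dots> = (\<integral>\<^sup>+\<theta>. (\<integral>\<^sup>+u. \<phi> u \<partial>p \<theta>) \<partial>?R)"
    by (rule nn_integral_bind[OF \<phi> p_R])
  also have "\<dots> = (\<integral>\<^sup>+\<theta>. (\<integral>\<^sup>+u. \<phi> u \<partial>p \<theta>) * indicator B \<theta> \<partial>distr N S \<Theta>)"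
    by (subst nn_integral_density)
      (auto simp: mult.commute intro!: measurable_compose[OF p_meas nn_integral_measurable_subprob_algebra[OF \<phi>]])
  also have "(\<integral>\<^sup>+u. \<phi> u \<partial>distr ?L borel U) = (\<integral>\<^sup>+\<omega>. \<phi> (U \<omega>) * indicator B (\<Theta> \<omega>) \<partial>N)"
    by (subst nn_integral_distr, measurable, subst nn_integral_density) (auto simp: mult.commute)
  finally show ?thesis .
qed

text \<open>Replaces the abstract weight b by 1 - U: conditioning on \<Theta> averages 1 - U to b.
  Integrability for the weighted law can then be checked on \<open>N\<close>.\<close>

lemma distr_density_eq_density_b_fun:
  assumes N: "prob_space N" and U [measurable]: "U \<in> borel_measurable N"
    and U_range: "\<forall>\<omega>\<in>space N. U \<omega> \<in> {0..1}"
    and \<Theta> [measurable]: "\<Theta> \<in> measurable N S"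
    and p: "regular_cond_law N U S \<Theta> p"
  shows "distr (density N (\<lambda>\<omega>. ennreal (1 - U \<omega>))) S \<Theta> = density (distr N S \<Theta>) (\<lambda>\<theta>. ennreal (b_fun p \<theta>))"
proof (rule measure_eqI)
  have p_prob: "p \<in> measurable S (prob_algebra borel)"
    using p by (simp add: regular_cond_law_def)
  then have p_meas [measurable]: "p \<in> measurable S (subprob_algebra borel)"
    by (rule measurable_prob_algebraD)
  \<comment> \<open>For exceptional \<theta> the kernel may charge points outside the unit interval;
    the indicator keeps \<open>\<phi>\<close> between 0 and 1 and hence integrable for every
    \<theta>.\<close>
  define \<phi> where "\<phi> u = indicator {0..1} u * (1 - u)" for u :: real
  have \<phi> [measurable]: "\<phi> \<in> borel_measurable borel" unfolding \<phi>_def by measurable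
  have b_eq: "b_fun p \<theta> = (\<integral>u. \<phi> u \<partial>p \<theta>)" for \<theta>
    by (simp add: b_fun_def set_lebesgue_integral_def \<phi>_def)
  have b_meas [measurable]: "b_fun p \<in> borel_measurable S"
    unfolding b_eq[abs_def] by (rule measurable_compose[OF p_meas integral_measurable_subprob_algebra[OF \<phi>]])
  have b_nn: "(\<integral>\<^sup>+u. ennreal (\<phi> u) \<partial>p \<theta>) = ennreal (b_fun p \<theta>)" if "\<theta> \<in> space S" for \<theta>
  proof -
    have \<theta>: "p \<theta> \<in> space (prob_algebra borel)" using p_prob that by (rule measurable_space)
    then interpret P: prob_space "p \<theta>" by (simp add: space_prob_algebra)
    have sets: "sets (p \<theta>) = sets borel" using \<theta> by (simp add: space_prob_algebra)
    have "integrable (p \<theta>) \<phi>"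
      by (rule P.integrable_const_bound[where B = 1])
        (auto simp: \<phi>_def split: split_indicator intro!: AE_I2 simp: measurable_cong_sets[OF sets refl])
    then show ?thesis
      unfolding b_eq by (rule nn_integral_eq_integral) (auto simp: \<phi>_def split: split_indicator)
  qed
  fix B assume "B \<in> sets (distr (density N (\<lambda>\<omega>. ennreal (1 - U \<omega>))) S \<Theta>)"
  then have B [measurable]: "B \<in> sets S" by simp
  have "emeasure (distr (density N (\<lambda>\<omega>. ennreal (1 - U \<omega>))) S \<Theta>) B
      = (\<integral>\<^sup>+\<omega>. ennreal (\<phi> (U \<omega>)) * indicator B (\<Theta> \<omega>) \<partial>N)"
    by (subst emeasure_distr, measurable, subst emeasure_density, measurable)
      (use U_range in \<open>auto intro!: nn_integral_cong simp: \<phi>_def split: split_indicator\<close>)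
  also have "\<dots> = (\<integral>\<^sup>+\<theta>. (\<integral>\<^sup>+u. ennreal (\<phi> u) \<partial>p \<theta>) * indicator B \<theta> \<partial>distr N S \<Theta>)"
    by (rule regular_cond_law_nn_integral[OF N U \<Theta> p B]) measurable
  also have "\<dots> = emeasure (density (distr N S \<Theta>) (\<lambda>\<theta>. ennreal (b_fun p \<theta>))) B"
    by (subst emeasure_density) (auto intro!: nn_integral_cong simp: b_nn)
  finally show "emeasure (distr (density N (\<lambda>\<omega>. ennreal (1 - U \<omega>))) S \<Theta>) B
      = emeasure (density (distr N S \<Theta>) (\<lambda>\<theta>. ennreal (b_fun p \<theta>))) B" .
qed simp

text \<open>Measurability of \<open>f\<close> stands on its own because integrability of the
  composition with \<Theta> does not imply it.\<close>

lemma L1_plus_iff: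
  fixes f :: "'v \<Rightarrow> real"
  assumes N: "prob_space N" and U [measurable]: "U \<in> borel_measurable N"
    and U_range: "\<forall>\<omega>\<in>space N. U \<omega> \<in> {0..1}"
    and \<Theta> [measurable]: "\<Theta> \<in> measurable N S"
    and p: "regular_cond_law N U S \<Theta> p"
  shows "f \<in> L1_plus (distr N S \<Theta>) (b_fun p) \<longleftrightarrow>
    (\<forall>\<theta>\<in>space S. 0 \<le> f \<theta>) \<and> f \<in> borel_measurable S \<and> integrable N (\<lambda>\<omega>. (1 - U \<omega>) * f (\<Theta> \<omega>))"
proof -
  have "integrable (distr (density N (\<lambda>\<omega>. ennreal (1 - U \<omega>))) S \<Theta>) f \<longleftrightarrow>
      integrable N (\<lambda>\<omega>. (1 - U \<omega>) * f (\<Theta> \<omega>))" if [measurable]: "f \<in> borel_measurable S"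
    by (subst integrable_distr_eq, measurable, subst integrable_real_density)
      (use U_range in \<open>auto intro!: AE_I2\<close>)
  moreover have "f \<in> borel_measurable S" if "integrable (distr (density N (\<lambda>\<omega>. ennreal (1 - U \<omega>))) S \<Theta>) f"
    using borel_measurable_integrable[OF that] by simp
  ultimately show ?thesis
    unfolding L1_plus_def mem_Collect_eq
      distr_density_eq_density_b_fun[OF N U U_range \<Theta> p, symmetric] by auto
qed

text \<open>Bounds the real supremum that expresses the optimality of \<open>g\<close>; an unbounded
  family would give that supremum no meaning. The minimum is at most U, and if it is not integrable
  its integral is 0.\<close>

lemma Lambda_le_one:
  assumes "integrable N U" and "\<And>\<omega>. \<omega> \<in> space N \<Longrightarrow> 0 \<le> U \<omega>"
  shows "Lambda N U \<Theta> f \<le> 1"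
proof -
  have "(\<integral>\<omega>. min (U \<omega>) ((1 - U \<omega>) * f (\<Theta> \<omega>)) \<partial>N) \<le> (\<integral>\<omega>. U \<omega> \<partial>N)"
    using assms by (intro integral_mono') auto
  moreover have "0 \<le> (\<integral>\<omega>. U \<omega> \<partial>N)" using assms(2) by (rule Bochner_Integration.integral_nonneg)
  ultimately show ?thesis by (cases "(\<integral>\<omega>. U \<omega> \<partial>N) = 0") (auto simp: Lambda_def divide_le_eq_1)
qed

section \<open>Homogeneous extension\<close>

context pareto_breiman
begin

lemma hom_ext_homogeneous: "homogeneous (hom_ext \<tau>X g)"
  unfolding homogeneous_def
proof (intro allI impI)
  fix c :: real and x :: "real ^ 'd" assume c: "0 \<le> c"
  have tau_eq: "\<tau>X (c *\<^sub>R x) = c * \<tau>X x"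
    using tauX_homogeneous c unfolding homogeneous_def by blast
  show "hom_ext \<tau>X g (c *\<^sub>R x) = c * hom_ext \<tau>X g x"
  proof (cases "c = 0")
    case False
    then have "inverse (c * \<tau>X x) * c = inverse (\<tau>X x)" by (simp add: inverse_mult_distrib)
    then have "(c *\<^sub>R x) /\<^sub>R \<tau>X (c *\<^sub>R x) = x /\<^sub>R \<tau>X x" by (simp only: tau_eq scaleR_scaleR)
    then show ?thesis using False by (simp only: hom_ext_def tau_eq) simp
  qed (simp add: hom_ext_def homogeneous_zero[OF tauX_homogeneous])
qed

lemma tauX_normalize:
  assumes "\<tau>X x \<noteq> 0"
  shows "\<tau>X (x /\<^sub>R \<tau>X x) = 1"
proof -
  have "0 \<le> inverse (\<tau>X x)" using tauX_nonneg by simp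
  then have "\<tau>X (x /\<^sub>R \<tau>X x) = inverse (\<tau>X x) * \<tau>X x"
    using tauX_homogeneous unfolding homogeneous_def by blast
  then show ?thesis using assms by simp
qed

lemma hom_ext_measurable:
  assumes "g \<in> borel_measurable (SX \<tau>X)"
  shows "hom_ext \<tau>X g \<in> borel_measurable borel"
proof -
  \<comment> \<open>\<open>g\<close> is measurable only on the set where \<open>\<tau>X\<close> is
    1, so it is extended by 0. Normalized points lie in that set unless
    \<open>\<tau>X x = 0\<close>, and then the factor \<open>\<tau>X x\<close> hides the
    value.\<close>
  define g' where "g' x = indicator {x. \<tau>X x = 1} x *\<^sub>R g x" for x
  have "{x. \<tau>X x = 1} = \<tau>X -` {1} \<inter> space borel" by auto
  also have "\<dots> \<in> sets borel" by (rule measurable_sets[OF model_measurable(4)]) simp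
  finally have g': "g' \<in> borel_measurable borel"
    using assms unfolding g'_def by (subst (asm) borel_measurable_restrict_space_iff) auto
  have norm: "(\<lambda>x. x /\<^sub>R \<tau>X x) \<in> borel_measurable borel" by measurable
  have "hom_ext \<tau>X g x = \<tau>X x * g' (x /\<^sub>R \<tau>X x)" for x
    using tauX_normalize[of x] by (simp add: hom_ext_def g'_def)
  then have "hom_ext \<tau>X g = (\<lambda>x. \<tau>X x * g' (x /\<^sub>R \<tau>X x))" by (rule ext)
  also have "\<dots> \<in> borel_measurable borel"
    by (intro borel_measurable_times model_measurable measurable_compose[OF norm g'])
  finally show ?thesis .
qed

lemma hom_ext_nonneg:
  assumes "\<And>x. \<tau>X x = 1 \<Longrightarrow> 0 \<le> g x"
  shows "0 \<le> hom_ext \<tau>X g x"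
  using assms tauX_normalize tauX_nonneg by (simp add: hom_ext_def)

lemma hom_ext_eq: "\<tau>X x = 1 \<Longrightarrow> hom_ext \<tau>X g x = g x"
  by (simp add: hom_ext_def)

end

theorem corollary3p1:
  fixes M :: "'a measure" and \<xi> V :: "'a \<Rightarrow> real" and W :: "'a \<Rightarrow> real ^ 'd"
    and \<tau>X :: "real ^ 'd \<Rightarrow> real" and c\<xi> :: real
    and N :: "'b measure" and \<sigma>X :: "(real ^ 'd) measure"
    and \<Theta>Z :: "'b \<Rightarrow> real \<times> (real ^ 'd)" and U :: "'b \<Rightarrow> real" and \<Theta> :: "'b \<Rightarrow> real ^ 'd"
    and \<theta>s :: "real ^ 'd" and p :: "real ^ 'd \<Rightarrow> real measure"
    and g :: "real ^ 'd \<Rightarrow> real"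
    and Y :: "'a \<Rightarrow> real" and X :: "'a \<Rightarrow> real ^ 'd"
    and p\<Theta> :: "(real ^ 'd) measure" and L1 :: "(real ^ 'd \<Rightarrow> real) set"
  defines "Y \<equiv> \<lambda>\<omega>. \<xi> \<omega> * V \<omega>" and "X \<equiv> \<lambda>\<omega>. \<xi> \<omega> *\<^sub>R W \<omega>"
    and "p\<Theta> \<equiv> distr N (SX \<tau>X) \<Theta>"
    and "L1 \<equiv> L1_plus p\<Theta> (b_fun p)"
  assumes model: "pareto_breiman_limit M \<xi> V W \<tau>X c\<xi> N \<sigma>X \<Theta>Z U \<Theta> \<theta>s"
    and p: "regular_cond_law N U (SX \<tau>X) \<Theta> p"
    and g_L1: "g \<in> L1"
    and g_C: "C_fun N U \<Theta> g = (\<integral>\<omega>. U \<omega> \<partial>N)"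
    and g_max: "Lambda N U \<Theta> g =
      (SUP f\<in>{f \<in> L1. C_fun N U \<Theta> f = (\<integral>\<omega>. U \<omega> \<partial>N)}. Lambda N U \<Theta> f)"
  shows "(((\<lambda>t. t * \<P>(\<omega> in M. Y \<omega> > t)) \<longlongrightarrow>
        c\<xi> * (\<integral>\<omega>. tau \<tau>X (V \<omega>, W \<omega>) \<partial>M) * C_fun N U \<Theta> g) at_top \<and>
      ((\<lambda>t. t * \<P>(\<omega> in M. hom_ext \<tau>X g (X \<omega>) > t)) \<longlongrightarrow>
        c\<xi> * (\<integral>\<omega>. tau \<tau>X (V \<omega>, W \<omega>) \<partial>M) * C_fun N U \<Theta> g) at_top) \<and>
      (\<forall>h. (\<forall>x. 0 \<le> h x) \<and> homogeneous h \<and> h \<in> borel_measurable borel \<and>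
          {x. h x > 0} \<subseteq> {x. \<tau>X x > 0} \<and>
          (\<lambda>t. \<P>(\<omega> in M. Y \<omega> > t)) \<sim>[at_top] (\<lambda>t. \<P>(\<omega> in M. h (X \<omega>) > t)) \<longrightarrow>
        h \<in> L1 \<and>
        has_tail_dependence M Y (\<lambda>\<omega>. h (X \<omega>)) (Lambda N U \<Theta> h) \<and>
        ((\<lambda>t. \<P>(\<omega> in M. Y \<omega> > t \<bar> h (X \<omega>) > t)) \<longlongrightarrow> Lambda N U \<Theta> h) at_top \<and>
        Lambda N U \<Theta> h \<le> Lambda N U \<Theta> g \<and>
        has_tail_dependence M Y (\<lambda>\<omega>. hom_ext \<tau>X g (X \<omega>)) (Lambda N U \<Theta> g))"
proof -
  interpret pareto_breiman_limit M \<xi> V W \<tau>X c\<xi> N \<sigma>X \<Theta>Z U \<Theta> \<theta>s by (rule model)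
  let ?R = "expectation (\<lambda>\<omega>. tau \<tau>X (V \<omega>, W \<omega>))"
  have "\<forall>\<omega>\<in>space N. U \<omega> \<in> {0..1}" using U_range by blast
  note L1_iff = L1_plus_iff[OF N.prob_space_axioms U_measurable this Theta_measurable p,
      folded p\<Theta>_def, folded L1_def]
  have \<kappa>_pos: "0 < c\<xi> * (?R * N.expectation U)"
    using c_xi_pos tau_expectation_pos U_expectation_pos by simp
  have g_meas: "g \<in> borel_measurable (SX \<tau>X)" and g_nonneg: "\<And>x. \<tau>X x = 1 \<Longrightarrow> 0 \<le> g x"
    and g_int: "integrable N (\<lambda>\<omega>. (1 - U \<omega>) * g (\<Theta> \<omega>))"
    using g_L1 by (auto simp: L1_iff space_restrict_space)

  let ?h = "hom_ext \<tau>X g"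
  have hg: "homogeneous ?h" "?h \<in> borel_measurable borel" "\<And>x. 0 \<le> ?h x" "\<And>x. \<tau>X x = 0 \<Longrightarrow> ?h x = 0"
    using hom_ext_homogeneous hom_ext_measurable[OF g_meas] hom_ext_nonneg g_nonneg
    by (blast, blast, blast, simp add: hom_ext_def)
  \<comment> \<open>\<Theta> takes values where \<open>\<tau>X\<close> is 1, and there the extension
    coincides with \<open>g\<close>; hence C and \<Lambda> do not distinguish the two.\<close>
  have C_hg: "C_fun N U \<Theta> ?h = C_fun N U \<Theta> g"
    unfolding C_fun_def by (intro Bochner_Integration.integral_cong) (simp_all add: hom_ext_eq tauX_Theta)
  have Lambda_hg: "Lambda N U \<Theta> ?h = Lambda N U \<Theta> g"
    unfolding Lambda_def
    by (intro arg_cong2[where f = "(/)"] Bochner_Integration.integral_cong)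
      (simp_all add: hom_ext_eq tauX_Theta)
  have "integrable N (\<lambda>\<omega>. (1 - U \<omega>) * ?h (\<Theta> \<omega>))"
    using g_int by (subst Bochner_Integration.integrable_cong[OF refl]) (auto simp: hom_ext_eq tauX_Theta)
  then have hg_int: "integrable M (\<lambda>\<omega>. ?h (W \<omega>))"
    by (simp add: integrable_h_iff[OF hg])
  have g_dep: "has_tail_dependence M Y (\<lambda>\<omega>. ?h (X \<omega>)) (Lambda N U \<Theta> g)"
    unfolding Y_def X_def using tail_dependence_h(1)[OF hg hg_int] by (simp add: C_hg g_C Lambda_hg)

  show ?thesis
  proof (intro conjI allI impI)
    show "((\<lambda>t. t * \<P>(\<omega> in M. Y \<omega> > t)) \<longlongrightarrow> c\<xi> * ?R * C_fun N U \<Theta> g) at_top"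
      unfolding Y_def g_C using Y_tail by (simp add: mult.assoc)
    show "((\<lambda>t. t * \<P>(\<omega> in M. ?h (X \<omega>) > t)) \<longlongrightarrow> c\<xi> * ?R * C_fun N U \<Theta> g) at_top"
      unfolding X_def using h_tail[OF hg hg_int] by (simp add: mult.assoc C_hg)
  next
    fix h :: "real ^ 'd \<Rightarrow> real"
    assume asm: "(\<forall>x. 0 \<le> h x) \<and> homogeneous h \<and> h \<in> borel_measurable borel \<and>
        {x. h x > 0} \<subseteq> {x. \<tau>X x > 0} \<and>
        (\<lambda>t. \<P>(\<omega> in M. Y \<omega> > t)) \<sim>[at_top] (\<lambda>t. \<P>(\<omega> in M. h (X \<omega>) > t))"
    then have equiv: "(\<lambda>t. \<P>(\<omega> in M. Y \<omega> > t)) \<sim>[at_top] (\<lambda>t. \<P>(\<omega> in M. h (X \<omega>) > t))" by blast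
    have h: "homogeneous h" "h \<in> borel_measurable borel" "\<And>x. 0 \<le> h x" using asm by auto
    have h_supp: "h x = 0" if "\<tau>X x = 0" for x
    proof -
      have "\<not> 0 < h x" using asm that by force
      then show ?thesis using h(3)[of x] by simp
    qed
    note h = h h_supp
    \<comment> \<open>Tail equivalence with Y transfers the constant of Y to \<open>h (X)\<close>;
      integrability of h(W) follows from this limit.\<close>
    have "(\<lambda>t. t * \<P>(\<omega> in M. h (X \<omega>) > t)) \<sim>[at_top] (\<lambda>t. t * \<P>(\<omega> in M. Y \<omega> > t))"
      by (intro asymp_equiv_mult asymp_equiv_refl asymp_equiv_symI[OF equiv])
    then have lim: "((\<lambda>t. t * \<P>(\<omega> in M. h (X \<omega>) > t)) \<longlongrightarrow> c\<xi> * (?R * N.expectation U)) at_top"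
      using Y_tail unfolding Y_def by (rule asymp_equiv_tendsto_transfer[OF asymp_equiv_symI])
    have int: "integrable M (\<lambda>\<omega>. h (W \<omega>))"
      by (rule integrable_h[OF h lim[unfolded X_def]])
    \<comment> \<open>Now that h(W) is integrable, Breiman's lemma gives the tail constant of
      \<open>h (X)\<close> a second time; equating the two limits shows that \<open>h\<close>
      satisfies the constraint under which \<open>g\<close> is optimal.\<close>
    have "c\<xi> * (?R * C_fun N U \<Theta> h) = c\<xi> * (?R * N.expectation U)"
      by (rule tendsto_unique[OF _ h_tail[OF h int] lim[unfolded X_def]]) simp
    then have C: "C_fun N U \<Theta> h = N.expectation U"
      using c_xi_pos tau_expectation_pos by simp
    show h_L1: "h \<in> L1"
      unfolding L1_iff
      using int h measurable_restrict_space1[OF h(2)] by (simp add: integrable_h_iff[OF h])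
    show "has_tail_dependence M Y (\<lambda>\<omega>. h (X \<omega>)) (Lambda N U \<Theta> h)"
      unfolding X_def Y_def by (rule tail_dependence_h(1)[OF h int C])
    show "((\<lambda>t. \<P>(\<omega> in M. Y \<omega> > t \<bar> h (X \<omega>) > t)) \<longlongrightarrow> Lambda N U \<Theta> h) at_top"
      unfolding X_def Y_def by (rule tail_dependence_h(2)[OF h int C])
    show "Lambda N U \<Theta> h \<le> Lambda N U \<Theta> g"
      unfolding g_max
    proof (rule cSUP_upper)
      show "bdd_above (Lambda N U \<Theta> ` {f \<in> L1. C_fun N U \<Theta> f = N.expectation U})"
        using Lambda_le_one[OF U_integrable] U_range by (intro bdd_aboveI[of _ 1]) auto
    qed (use h_L1 C in auto)
    show "has_tail_dependence M Y (\<lambda>\<omega>. ?h (X \<omega>)) (Lambda N U \<Theta> g)" by (rule g_dep)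
  qed
qed

end
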